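(* Let $m,n\in\mathbb N$ with $m\ge2$, let $p>2$ be a real number, and let $f\in h^p(\mathbb U^n)$. Then $$\|f\|_{b^{mp}_{\mathbf{m-2}}(\mathbb U^n)}\le D_m^{2n/p}\,\|f\|_{h^p(\mathbb U^n)},\qquad\text{where } D_m=\sqrt2\cos\left(\frac{\pi}{4m}\right).$$
   Context: $\mathbb U$ is the open unit disc in $\mathbb C$, $\mathbb T$ the unit circle, $\mathbb U^n$ the unit polydisc, and $dm_n$ is normalized Haar measure on $\mathbb T^n$. A complex-valued $f\in C^2(\mathbb U^n)$ is pluriharmonic if $\partial^2 f/\partial z_j\partial\overline z_k=0$ for all $1\le j,k\le n$. For $0<p<\infty$, $h^p(\mathbb U^n)$ is the set of complex-valued pluriharmonic $f$ on $\mathbb U^n$ with $$\|f\|_{h^p(\mathbb U^n)}=\sup_{0<r<1}\Big(\int_{\mathbb T^n}|f(r\omega)|^p\,dm_n(\omega)\Big)^{1/p}<\infty.$$ For an integer $m\ge2$, $$d\mu_{\mathbf{m-2}}(z)=\frac{(m-1)^n}{\pi^n}\prod_{k=1}^n(1-|z_k|^2)^{m-2}\,dx_k\,dy_k,\qquad z_k=x_k+iy_k,$$ and for $0<q<\infty$, $\|f\|_{b^q_{\mathbf{m-2}}(\mathbb U^n)}=\big(\int_{\mathbb U^n}|f|^q\,d\mu_{\mathbf{m-2}}\big)^{1/q}$. *)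

theory Defs
  imports "HOL-Probability.Probability"
begin

section \<open>Polydisc, torus and their measures\<close>

definition polydisc :: "(complex ^ 'n) set" where
  "polydisc = {z. \<forall>k. cmod (z $ k) < 1}"

definition torus :: "(complex ^ 'n) set" where
  "torus = {w. \<forall>k. cmod (w $ k) = 1}"

text \<open>Normalized Haar measure on the torus: the image of the product of the uniform
  probability measures on the angle intervals \<open>[0, 2\<pi>)\<close>.\<close>

definition torus_haar :: "(complex ^ 'n) measure" where
  "torus_haar =
     distr (\<Pi>\<^sub>M k\<in>(UNIV :: 'n set). uniform_measure lborel {0..<2 * pi})
       (restrict_space borel torus) (\<lambda>t. \<chi> k. cis (t k))"

definition bergman_measure :: "nat \<Rightarrow> (complex ^ 'n) measure" where
  "bergman_measure m =
     density (restrict_space lborel polydisc)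
       (\<lambda>z. ennreal ((real m - 1) ^ CARD('n) / pi ^ CARD('n)
                      * (\<Prod>k\<in>UNIV. (1 - (cmod (z $ k))\<^sup>2) ^ (m - 2))))"


section \<open>Pluriharmonic functions\<close>

text \<open>Differentiability is over the reals. As the domain has finite dimension, continuity of
  the derivative in each fixed direction is the same as continuity of the derivative as a
  map into the space of linear operators.\<close>

definition C1_on :: "('a::euclidean_space) set \<Rightarrow> ('a \<Rightarrow> 'b::real_normed_vector) \<Rightarrow> bool" where
  "C1_on S f \<longleftrightarrow>
     (\<forall>x\<in>S. f differentiable (at x)) \<and>
     (\<forall>v. continuous_on S (\<lambda>x. frechet_derivative f (at x) v))"

definition C2_on :: "('a::euclidean_space) set \<Rightarrow> ('a \<Rightarrow> 'b::real_normed_vector) \<Rightarrow> bool" where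
  "C2_on S f \<longleftrightarrow>
     C1_on S f \<and> (\<forall>v. C1_on S (\<lambda>x. frechet_derivative f (at x) v))"

text \<open>The Wirtinger operators
  \<open>\<partial>/\<partial>z\<^sub>j = (\<partial>/\<partial>x\<^sub>j - \<i> \<partial>/\<partial>y\<^sub>j)/2\<close> and its conjugate, with \<open>\<partial>/\<partial>x\<^sub>j\<close> and
  \<open>\<partial>/\<partial>y\<^sub>j\<close> the derivatives in the directions \<open>axis j 1\<close> and \<open>axis j \<i>\<close>.\<close>

definition wirtinger :: "'n \<Rightarrow> (complex ^ 'n \<Rightarrow> complex) \<Rightarrow> complex ^ 'n \<Rightarrow> complex" where
  "wirtinger j f z =
     (frechet_derivative f (at z) (axis j 1) - \<i> * frechet_derivative f (at z) (axis j \<i>)) / 2"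

definition wirtinger_bar :: "'n \<Rightarrow> (complex ^ 'n \<Rightarrow> complex) \<Rightarrow> complex ^ 'n \<Rightarrow> complex" where
  "wirtinger_bar k f z =
     (frechet_derivative f (at z) (axis k 1) + \<i> * frechet_derivative f (at z) (axis k \<i>)) / 2"

definition pluriharmonic_on :: "(complex ^ 'n) set \<Rightarrow> (complex ^ 'n \<Rightarrow> complex) \<Rightarrow> bool" where
  "pluriharmonic_on S f \<longleftrightarrow>
     C2_on S f \<and> (\<forall>j k. \<forall>z\<in>S. wirtinger j (wirtinger_bar k f) z = 0)"


section \<open>Norms and spaces\<close>

text \<open>The norms take values in \<^typ>\<open>ennreal\<close>, so that an infinite norm is not confused with
  a default value of the integral or of the supremum. The power below is meant for
  exponents \<open>a > 0\<close>.\<close>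

definition ennreal_powr :: "ennreal \<Rightarrow> real \<Rightarrow> ennreal" where
  "ennreal_powr x a = (if x = \<infinity> then \<infinity> else ennreal (enn2real x powr a))"

definition hp_norm :: "real \<Rightarrow> (complex ^ 'n \<Rightarrow> complex) \<Rightarrow> ennreal" where
  "hp_norm p f =
     (SUP r\<in>{0<..<1::real}.
        ennreal_powr (\<integral>\<^sup>+ w. ennreal (cmod (f (r *\<^sub>R w)) powr p) \<partial>torus_haar) (1 / p))"

definition hp_space :: "real \<Rightarrow> (complex ^ 'n \<Rightarrow> complex) set" where
  "hp_space p = {f. pluriharmonic_on polydisc f \<and> hp_norm p f < \<infinity>}"

definition bergman_norm :: "nat \<Rightarrow> real \<Rightarrow> (complex ^ 'n \<Rightarrow> complex) \<Rightarrow> ennreal" where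
  "bergman_norm m q f =
     ennreal_powr (\<integral>\<^sup>+ z. ennreal (cmod (f z) powr q) \<partial>bergman_measure m) (1 / q)"

definition D_const :: "nat \<Rightarrow> real" where
  "D_const m = sqrt 2 * cos (pi / (4 * real m))"

end

(*
  Powers |f|^(p/2) of a pluriharmonic f are dominated, in each variable separately, by the Poisson
  integral of their boundary values (decompose each slice into a holomorphic and an antiholomorphic
  part, then apply Jensen). Hence it suffices to bound by D_m the norm of the Poisson integral from
  L^2(T) to L^(2m)(U, mu_(m-2)) in one variable; Minkowski's inequality then gives D_m^n in n
  variables, and raising to the power 2/p yields the constant of the theorem.

  In one variable write the Poisson integral as Re F with F holomorphic and F(0) = a. Expanding F^m
  and using Cauchy-Schwarz on its coefficients, the integral of |F|^(2m) is at most
  (sum |a_k|^2)^m, and sum |a_k|^2 <= 2 |phi|_2^2 - a^2 by Bessel. The constant improves from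
  sqrt 2 to D_m through, with s = pi/(4m),
    (Re z)^(2m) <= (cos s)^(2m) (|z|^(2m) + tan s Re z^(2m)),
  since the integral of F^(2m) is a^(2m) and (2 S - a^2)^m + a^(2m) <= (2 S)^m.
*)

theory Submission
  imports Defs "HOL-Complex_Analysis.Complex_Analysis"
begin

no_notation fps_nth (infixl "$" 75)

section \<open>A pointwise inequality for powers of the real part\<close>

text \<open>The weight exponent m - 2 is the one for which the loss in Cauchy-Schwarz disappears.
  The k-th coefficient of F^m is a sum over the (k + m - 1 choose m - 1) ways of writing k as an
  ordered sum of m naturals. Cauchy-Schwarz costs exactly this binomial factor, and its reciprocal
  is the integral of |z|^(2k) against mu_(m-2).

  In several variables it is the squares that tensorize: the one-variable bound, read for squares,
  goes from L^1 to L^m with constant D_m^2, which is the form Minkowski's inequality accepts. This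
  singles out the exponent p/2: the square of |f|^(p/2) is |f|^p, its 2m-th power is |f|^(mp), and p
  > 2 makes t^(p/2) convex, as Jensen requires.

  The obstacle is the boundary: f need not extend continuously to the torus. All estimates are
  therefore made for f(r z) with r < 1, uniformly in r, and Fatou's lemma recovers f. In the same
  way F is replaced by its Taylor polynomials, with a bound independent of the degree, and a second
  use of Fatou's lemma returns to the Poisson integral.\<close>

lemma has_real_derivative_cos_multiple_div:
  fixes k :: nat and t :: real
  assumes "cos t \<noteq> 0"
  shows "((\<lambda>t. cos (real (Suc k) * t) / cos t ^ Suc k) has_real_derivative
           - (real (Suc k) * sin (real k * t) / cos t ^ Suc (Suc k))) (at t)"
proof -
  have e: "real (Suc k) * t - t = real k * t" by (simp add: algebra_simps)
  have *: "sin (real k * t) = sin (real (Suc k) * t) * cos t - cos (real (Suc k) * t) * sin t"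
    by (subst e[symmetric], rule sin_diff)
  have p: "((\<lambda>t. cos t ^ Suc k) has_real_derivative real (Suc k) * (cos t ^ k * - sin t)) (at t)"
    using DERIV_power_Suc[OF DERIV_cos, where n=k and x=t] by (simp add: mult_ac)
  have c: "((\<lambda>t. cos (real (Suc k) * t)) has_real_derivative - sin (real (Suc k) * t) * real (Suc k)) (at t)"
    by (auto intro!: derivative_eq_intros)
  have "((\<lambda>t. cos (real (Suc k) * t) / cos t ^ Suc k) has_real_derivative
     ((- sin (real (Suc k) * t) * real (Suc k)) * cos t ^ Suc k
        - cos (real (Suc k) * t) * (real (Suc k) * (cos t ^ k * - sin t))) / (cos t ^ Suc k * cos t ^ Suc k)) (at t)"
    using assms by (intro DERIV_divide p c) simp
  also have "((- sin (real (Suc k) * t) * real (Suc k)) * cos t ^ Suc k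
        - cos (real (Suc k) * t) * (real (Suc k) * (cos t ^ k * - sin t))) / (cos t ^ Suc k * cos t ^ Suc k)
     = - (real (Suc k) * sin (real k * t) / cos t ^ Suc (Suc k))"
    unfolding * using assms by (simp add: divide_simps) (simp add: algebra_simps)
  finally show ?thesis .
qed

text \<open>The derivative of the quotient is
  \<open>- k * sin ((k - 1) * t) / cos t ^ (k + 1)\<close>, and the hypothesis
  \<open>n * t <= pi\<close> keeps every sine that occurs nonnegative.\<close>

lemma cos_multiple_div_antimono:
  fixes k n :: nat and s t :: real
  assumes "0 \<le> s" "s \<le> t" "k \<le> n" "n > 0" "real n * t \<le> pi" "t < pi / 2"
  shows "cos (real k * t) / cos t ^ k \<le> cos (real k * s) / cos s ^ k"
proof (cases k)
  case (Suc l)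
  show ?thesis unfolding Suc
  proof (rule DERIV_nonpos_imp_nonincreasing[OF \<open>s \<le> t\<close>])
    fix x assume x: "s \<le> x" "x \<le> t"
    have c: "cos x > 0" using x assms by (intro cos_gt_zero_pi) auto
    have "real l * x \<le> real n * t" using x assms Suc by (intro mult_mono) auto
    hence "sin (real l * x) \<ge> 0" using x assms by (intro sin_ge_zero) auto
    hence "- (real (Suc l) * sin (real l * x) / cos x ^ Suc (Suc l)) \<le> 0"
      using c by simp
    thus "\<exists>y. ((\<lambda>t. cos (real (Suc l) * t) / cos t ^ Suc l) has_real_derivative y) (at x) \<and> y \<le> 0"
      using has_real_derivative_cos_multiple_div[of x l] c by (metis less_irrefl)
  qed
qed auto

text \<open>After division by powers of \<open>cos t\<close> the addition formula telescopes:
  \<open>sin (n * t) / cos t ^ n\<close> changes by \<open>tan t * cos (n * t) / cos t ^ n\<close>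
  when \<open>n\<close> grows by 1. In \<open>cos_power_le\<close> this makes the derivative of
  \<open>cos (n * t)\<close> comparable with that of \<open>cos t ^ n\<close>, the ratio being a
  monotone sum.\<close>

lemma sin_multiple_sum:
  fixes t :: real
  assumes "cos t \<noteq> 0"
  shows "sin (real n * t) * cos t = sin t * cos t ^ n * (\<Sum>k<n. cos (real k * t) / cos t ^ k)"
proof (induction n)
  case (Suc n)
  have "sin (real (Suc n) * t) * cos t = sin (real n * t) * cos t * cos t + cos (real n * t) * sin t * cos t"
    by (simp add: sin_add algebra_simps)
  also have "sin (real n * t) * cos t * cos t + cos (real n * t) * sin t * cos t =
     sin t * cos t ^ Suc n * (\<Sum>k<Suc n. cos (real k * t) / cos t ^ k)"
    unfolding Suc.IH using assms by (simp add: algebra_simps)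
  finally show ?case .
qed simp

text \<open>Both sides agree to first order at \<open>t = s\<close>, which fixes the coefficient \<open>tan s\<close>.\<close>

lemma cos_power_le:
  fixes n :: nat and t :: real
  assumes n: "n \<ge> 2" and t: "0 \<le> t" "t \<le> pi / 2"
  defines "s \<equiv> pi / (2 * real n)"
  shows "cos t ^ n \<le> cos s ^ n * (1 + tan s * cos (real n * t))"
proof -
  have s: "0 < s" "s \<le> pi / 4" "real n * s = pi / 2" "s < pi / 2"
    using n pi_gt_zero by (auto simp: s_def field_simps intro: order.strict_trans2)
  have cs: "cos s > 0" using s by (intro cos_gt_zero_pi) auto
  have ss: "sin s > 0" using s by (intro sin_gt_zero) auto
  obtain n' where n': "n = Suc n'" using n by (cases n) auto
  define b where "b = cos s ^ n * tan s"
  define S where "S t = (\<Sum>k<n. cos (real k * t) / cos t ^ k)" for t :: real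
  define g where "g t = cos s ^ n + b * cos (real n * t) - cos t ^ n" for t
  have b0: "b > 0" unfolding b_def using cs ss by (simp add: tan_def)
  have g': "(g has_real_derivative real n * (cos x ^ n' * sin x - b * sin (real n * x))) (at x)" for x
  proof -
    have p: "((\<lambda>t. cos t ^ n) has_real_derivative real n * (cos x ^ n' * - sin x)) (at x)"
      using DERIV_power_Suc[OF DERIV_cos, where n=n' and x=x] by (simp add: mult_ac n')
    have c: "((\<lambda>t. cos (real n * t)) has_real_derivative - sin (real n * x) * real n) (at x)"
      by (auto intro!: derivative_eq_intros)
    show ?thesis unfolding g_def
      using DERIV_diff[OF DERIV_add[OF DERIV_const DERIV_cmult[OF c]] p]
      by (simp add: algebra_simps)
  qed
  \<comment> \<open>As \<open>n * s\<close> is a right angle, the sum formula at \<open>s\<close>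
    gives \<open>b * S s = 1\<close>. Since \<open>S\<close> decreases, \<open>1 - b * S x\<close>,
    and with it the derivative of \<open>g\<close>, passes from minus to plus at \<open>s\<close>,
    so \<open>g s = 0\<close> is a minimum.\<close>
  have bS: "b * S s = 1"
  proof -
    have "sin (real n * s) = 1" unfolding s(3) by simp
    hence "cos s = (b * S s) * cos s"
      using sin_multiple_sum[of s n] cs unfolding S_def b_def tan_def by (simp add: mult_ac)
    thus ?thesis using cs by simp
  qed
  have S_mono: "S y \<le> S x" if "0 \<le> x" "x \<le> y" "y \<le> 2 * s" "y < pi / 2" for x y
  proof -
    have "real n * y \<le> real n * (2 * s)" using that by (intro mult_left_mono) auto
    also have "\<dots> = pi" using s by simp
    finally show ?thesis unfolding S_def using that n
      by (intro sum_mono cos_multiple_div_antimono[where n=n]) auto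
  qed
  have key: "cos x ^ n' * sin x - b * sin (real n * x) = cos x ^ n' * sin x * (1 - b * S x)" if "cos x > 0" for x
  proof -
    have "(b * sin (real n * x)) * cos x = b * (sin (real n * x) * cos x)" by (simp only: mult.assoc)
    also have "\<dots> = b * (sin x * cos x ^ n * S x)"
      unfolding S_def using that by (subst sin_multiple_sum) auto
    also have "\<dots> = (cos x ^ n' * sin x * (b * S x)) * cos x" by (simp add: n' mult_ac)
    finally have "(b * sin (real n * x)) * cos x = (cos x ^ n' * sin x * (b * S x)) * cos x" .
    hence "b * sin (real n * x) = cos x ^ n' * sin x * (b * S x)"
      by (metis mult_right_cancel that less_irrefl)
    thus ?thesis by (simp only: right_diff_distrib mult_1_right)
  qed
  have gs: "g s = 0" unfolding g_def s(3) by simp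
  have near: "g t \<ge> 0" if "0 \<le> t" "t \<le> 2 * s" "t < pi / 2" for t
  proof (cases "t \<le> s")
    case True
    have "g s \<le> g t"
    proof (rule DERIV_nonpos_imp_nonincreasing[OF True])
      fix x assume x: "t \<le> x" "x \<le> s"
      have c: "cos x > 0" using x s that by (intro cos_gt_zero_pi) auto
      have d: "sin x \<ge> 0" using x s that by (intro sin_ge_zero) auto
      have "b * S s \<le> b * S x" using x s that b0 by (intro mult_left_mono S_mono) auto
      hence "real n * (cos x ^ n' * sin x * (1 - b * S x)) \<le> 0"
        using c d bS by (intro mult_nonneg_nonpos) auto
      thus "\<exists>y. (g has_real_derivative y) (at x) \<and> y \<le> 0"
        using g'[of x] key[OF c] by auto
    qed
    thus ?thesis using gs by simp
  next
    case False
    hence "s \<le> t" by simp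
    have "g s \<le> g t"
    proof (rule DERIV_nonneg_imp_nondecreasing[OF \<open>s \<le> t\<close>])
      fix x assume x: "s \<le> x" "x \<le> t"
      have c: "cos x > 0" using x s that by (intro cos_gt_zero_pi) auto
      have d: "sin x \<ge> 0" using x s that by (intro sin_ge_zero) auto
      have "b * S x \<le> b * S s" using x s that b0 by (intro mult_left_mono S_mono) auto
      hence "real n * (cos x ^ n' * sin x * (1 - b * S x)) \<ge> 0"
        using c d bS by (intro mult_nonneg_nonneg) auto
      thus "\<exists>y. (g has_real_derivative y) (at x) \<and> y \<ge> 0"
        using g'[of x] key[OF c] by auto
    qed
    thus ?thesis using gs by simp
  qed
  have tan1: "tan s \<le> 1"
    using tan_mono_le[of s "pi/4"] s by (simp add: tan_45)
  have ts0: "tan s > 0" using cs ss by (simp add: tan_def)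
  have s2: "2 * s \<le> pi / 2" using s by simp
  \<comment> \<open>At \<open>t = 2 * s\<close> the angle \<open>n * t\<close> is pi and the right
    side of the claim is smallest. Beyond this point \<open>cos t\<close> only decreases, so this
    one inequality settles all larger \<open>t\<close>. For \<open>n = 2\<close> the point is
    \<open>pi / 2\<close> itself, where \<open>cos\<close> vanishes and the division behind
    \<open>near\<close> breaks down; there \<open>tan s <= 1\<close> suffices.\<close>
  have end_pt: "cos (2 * s) ^ n \<le> cos s ^ n * (1 - tan s)"
  proof (cases "2 * s < pi / 2")
    case True
    have "real n * (2 * s) = pi" using s(3) by simp
    hence e: "cos (real n * (2 * s)) = -1" by (simp only: cos_pi)
    have "g (2 * s) \<ge> 0" using near[of "2 * s"] True s(1) by simp
    thus ?thesis unfolding g_def b_def e by (simp add: right_diff_distrib)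
  next
    case False
    hence "cos (2 * s) = 0" using s2 by (metis cos_pi_half not_less order_antisym)
    thus ?thesis using cs tan1 n by (auto simp: power_0_left)
  qed
  show ?thesis
  proof (cases "t < 2 * s")
    case True
    hence "g t \<ge> 0" using near[of t] t s2 by simp
    thus ?thesis unfolding g_def b_def by (simp add: distrib_left)
  next
    case False
    have "cos t \<le> cos (2 * s)" using False t s by (intro cos_monotone_0_pi_le) auto
    moreover have "cos t \<ge> 0" using t by (intro cos_ge_zero) auto
    ultimately have "cos t ^ n \<le> cos (2 * s) ^ n" by (intro power_mono)
    also note end_pt
    also have "cos s ^ n * (1 - tan s) \<le> cos s ^ n * (1 + tan s * cos (real n * t))"
    proof -
      have "tan s * (-1) \<le> tan s * cos (real n * t)" using ts0 by (intro mult_left_mono) auto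
      thus ?thesis using cs by (intro mult_left_mono) auto
    qed
    finally show ?thesis .
  qed
qed

text \<open>Polar form reduces this to \<open>cos_power_le\<close> with \<open>n = 2 * m\<close>,
  which by symmetry covers \<open>Re z >= 0\<close>. Since \<open>2 * m\<close> is even, a shift of
  the angle by pi changes neither side, which covers the other half-plane.\<close>

lemma Re_power_le:
  fixes m :: nat and z :: complex
  assumes m: "m \<ge> 1"
  defines "s \<equiv> pi / (4 * real m)"
  shows "Re z ^ (2 * m) \<le> cos s ^ (2 * m) * (cmod z ^ (2 * m) + tan s * Re (z ^ (2 * m)))"
proof -
  have s: "s = pi / (2 * real (2 * m))" by (simp add: s_def)
  have main: "cos t ^ (2 * m) \<le> cos s ^ (2 * m) * (1 + tan s * cos (real (2 * m) * t))"
    if "\<bar>t\<bar> \<le> pi / 2" for t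
    using cos_power_le[of "2 * m" "\<bar>t\<bar>"] m that unfolding s
    by (cases "t \<ge> 0") auto
  have per: "sin (2 * pi * real m) = 0" "cos (2 * pi * real m) = 1"
    using sin_2npi[of m] cos_2npi[of m] by (simp_all add: mult_ac)
  define t where "t = Arg z"
  have z: "z = of_real (cmod z) * cis t" unfolding t_def by (metis rcis_cmod_Arg rcis_def)
  have all: "cos t ^ (2 * m) \<le> cos s ^ (2 * m) * (1 + tan s * cos (real (2 * m) * t))"
  proof -
    consider "\<bar>t\<bar> \<le> pi / 2" | "\<bar>t - pi\<bar> \<le> pi / 2" | "\<bar>t + pi\<bar> \<le> pi / 2"
      using Arg_bounded[of z] unfolding t_def by linarith
    thus ?thesis
    proof cases
      case 2
      have "cos (real (2 * m) * (t - pi)) = cos (real (2 * m) * t - 2 * pi * real m)" by (simp add: algebra_simps)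
      also have "\<dots> = cos (real (2 * m) * t)" by (simp add: cos_diff per)
      finally have e: "cos (real (2 * m) * (t - pi)) = cos (real (2 * m) * t)" .
      show ?thesis using main[OF 2] unfolding e by (simp add: cos_diff)
    next
      case 3
      have "cos (real (2 * m) * (t + pi)) = cos (real (2 * m) * t + 2 * pi * real m)" by (simp add: algebra_simps)
      also have "\<dots> = cos (real (2 * m) * t)" by (simp add: cos_add per)
      finally have e: "cos (real (2 * m) * (t + pi)) = cos (real (2 * m) * t)" .
      show ?thesis using main[OF 3] unfolding e by simp
    qed (use main in auto)
  qed
  have "Re z = cmod z * cos t" by (subst z) simp
  hence "Re z ^ (2 * m) = cmod z ^ (2 * m) * cos t ^ (2 * m)" by (simp add: power_mult_distrib)
  moreover have "z ^ (2 * m) = of_real (cmod z ^ (2 * m)) * cis (real (2 * m) * t)"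
    by (subst z) (simp only: power_mult_distrib Complex.DeMoivre of_real_power)
  hence "Re (z ^ (2 * m)) = cmod z ^ (2 * m) * cos (real (2 * m) * t)" by simp
  ultimately show ?thesis
    using mult_left_mono[OF all, of "cmod z ^ (2 * m)"] by (simp add: algebra_simps)
qed

section \<open>Coefficients of powers of polynomials\<close>

text \<open>Encoded as a polynomial so that the sums of \<open>|a_i1|^2 ... |a_im|^2\<close> over
  \<open>i1 + ... + im = k\<close> are the coefficients of its m-th power, and the squared l2 norm
  of the coefficients of \<open>q\<close> is its value at 1.\<close>

definition norm2_poly :: "complex poly \<Rightarrow> real poly" where
  "norm2_poly q = map_poly (\<lambda>a. (cmod a)\<^sup>2) q"

lemma coeff_norm2_poly [simp]: "coeff (norm2_poly q) k = (cmod (coeff q k))\<^sup>2"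
  by (simp add: norm2_poly_def coeff_map_poly)

lemma coeff_norm2_poly_power_nonneg: "coeff (norm2_poly q ^ m) k \<ge> 0"
proof (induction m arbitrary: k)
  case (Suc m)
  thus ?case by (auto simp: coeff_mult intro!: sum_nonneg)
qed (auto simp: coeff_1)

text \<open>Hockey-stick identity; it adds up the weights of the Cauchy-Schwarz step below.\<close>

lemma sum_binomial_complement:
  "(\<Sum>i\<le>k. real ((k - i + m) choose m)) = real ((k + Suc m) choose Suc m)"
proof -
  have "(\<Sum>i\<le>k. real ((k - i + m) choose m)) = (\<Sum>i\<le>k. real ((i + m) choose m))"
    by (rule sum.reindex_bij_witness[of _ "\<lambda>i. k - i" "\<lambda>i. k - i"]) auto
  also have "\<dots> = real (\<Sum>i\<le>k. (m + i) choose m)" by (simp add: add.commute)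
  also have "(\<Sum>i\<le>k. (m + i) choose m) = (k + Suc m) choose Suc m"
    by (induction k) (auto simp: add_ac)
  finally show ?thesis .
qed

text \<open>\<open>(k + m) choose m\<close> counts the ways to write \<open>k\<close> as an ordered
  sum of \<open>m + 1\<close> naturals, so this is Cauchy-Schwarz for the expanded power. The
  induction splits off one factor. The other factor already carries the count for
  \<open>k - i\<close>, hence the unequal weights \<open>?B i\<close>, whose sum is the count with
  one more part.\<close>

lemma cmod_coeff_power_le:
  "(cmod (coeff (q ^ Suc m) k))\<^sup>2 \<le> real ((k + m) choose m) * coeff (norm2_poly q ^ Suc m) k"
proof (induction m arbitrary: k)
  case (Suc m)
  let ?B = "\<lambda>i. real ((k - i + m) choose m)"
  let ?c = "coeff (q ^ Suc m)"
  have B0: "?B i > 0" for i by simp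
  have "(cmod (coeff (q ^ Suc (Suc m)) k))\<^sup>2 = (cmod (\<Sum>i\<le>k. coeff q i * ?c (k - i)))\<^sup>2"
    by (simp add: coeff_mult)
  also have "\<dots> \<le> (\<Sum>i\<le>k. sqrt (?B i) * (cmod (coeff q i) * cmod (?c (k - i)) / sqrt (?B i)))\<^sup>2"
  proof (intro power_mono norm_ge_zero)
    have "cmod (\<Sum>i\<le>k. coeff q i * ?c (k - i)) \<le> (\<Sum>i\<le>k. cmod (coeff q i * ?c (k - i)))"
      by (rule norm_sum)
    also have "\<dots> = (\<Sum>i\<le>k. sqrt (?B i) * (cmod (coeff q i) * cmod (?c (k - i)) / sqrt (?B i)))"
      using B0 by (intro sum.cong) (simp_all add: norm_mult)
    finally show "cmod (\<Sum>i\<le>k. coeff q i * ?c (k - i)) \<le> \<dots>" .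
  qed
  also have "\<dots> \<le> (\<Sum>i\<le>k. (sqrt (?B i))\<^sup>2) * (\<Sum>i\<le>k. (cmod (coeff q i) * cmod (?c (k - i)) / sqrt (?B i))\<^sup>2)"
    by (rule Cauchy_Schwarz_ineq_sum)
  also have "(\<Sum>i\<le>k. (sqrt (?B i))\<^sup>2) = real ((k + Suc m) choose Suc m)"
    using sum_binomial_complement[of k m] by simp
  also have "(\<Sum>i\<le>k. (cmod (coeff q i) * cmod (?c (k - i)) / sqrt (?B i))\<^sup>2)
     \<le> (\<Sum>i\<le>k. coeff (norm2_poly q) i * coeff (norm2_poly q ^ Suc m) (k - i))"
  proof (rule sum_mono)
    fix i
    have "(cmod (?c (k - i)))\<^sup>2 / ?B i \<le> coeff (norm2_poly q ^ Suc m) (k - i)"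
      using Suc.IH[of "k - i"] B0[of i] by (simp add: divide_le_eq mult.commute)
    hence "(cmod (coeff q i))\<^sup>2 * ((cmod (?c (k - i)))\<^sup>2 / ?B i) \<le>
       (cmod (coeff q i))\<^sup>2 * coeff (norm2_poly q ^ Suc m) (k - i)"
      by (intro mult_left_mono) auto
    thus "(cmod (coeff q i) * cmod (?c (k - i)) / sqrt (?B i))\<^sup>2
      \<le> coeff (norm2_poly q) i * coeff (norm2_poly q ^ Suc m) (k - i)"
      by (simp add: power_mult_distrib power_divide)
  qed
  also have "\<dots> = coeff (norm2_poly q ^ Suc (Suc m)) k"
    by (simp add: coeff_mult)
  finally show ?case by (simp add: mult_left_mono)
qed simp

lemma poly_1_eq_sum_coeff: "poly p (1::real) = (\<Sum>i\<le>degree p. coeff p i)"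
  by (simp add: poly_altdef)

text \<open>Summing the coefficients of \<open>norm2_poly q ^ Suc m\<close> amounts to evaluating at
  1, which is multiplicative. The left side is the form in which
  \<open>integral_norm_poly_square_disc_measure\<close> will deliver the integral of
  \<open>|q ^ Suc m|^2\<close>.\<close>

lemma sum_cmod_coeff_power_le:
  "(\<Sum>k\<le>degree (q ^ Suc m). (cmod (coeff (q ^ Suc m) k))\<^sup>2 / real ((k + m) choose m))
     \<le> poly (norm2_poly q) 1 ^ Suc m"
proof -
  let ?n = "max (degree (q ^ Suc m)) (degree (norm2_poly q ^ Suc m))"
  have "(\<Sum>k\<le>degree (q ^ Suc m). (cmod (coeff (q ^ Suc m) k))\<^sup>2 / real ((k + m) choose m))
     \<le> (\<Sum>k\<le>degree (q ^ Suc m). coeff (norm2_poly q ^ Suc m) k)"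
    using cmod_coeff_power_le[of q m] by (intro sum_mono) (simp add: divide_le_eq mult.commute)
  also have "\<dots> \<le> (\<Sum>k\<le>?n. coeff (norm2_poly q ^ Suc m) k)"
    by (intro sum_mono2 coeff_norm2_poly_power_nonneg) auto
  also have "\<dots> = (\<Sum>k\<le>degree (norm2_poly q ^ Suc m). coeff (norm2_poly q ^ Suc m) k)"
    by (intro sum.mono_neutral_right) (auto simp: coeff_eq_0 simp del: power_Suc)
  also have "\<dots> = poly (norm2_poly q) 1 ^ Suc m"
    by (simp add: poly_1_eq_sum_coeff[symmetric] poly_power del: power_Suc)
  finally show ?thesis .
qed

section \<open>The weighted Bergman measure on the disc\<close>

lemma lborel_complex_eq_distr_pair:
  "(lborel :: complex measure) = distr (lborel \<Otimes>\<^sub>M lborel) borel (\<lambda>(x, y). Complex x y)"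
proof (rule lborel_eqI)
  have [measurable]: "(\<lambda>(x, y). Complex x y) \<in> borel_measurable (borel \<Otimes>\<^sub>M borel)"
    unfolding borel_prod case_prod_beta
    by (intro borel_measurable_continuous_onI continuous_intros)
  fix l u :: complex assume lu: "\<And>b. b \<in> Basis \<Longrightarrow> l \<bullet> b \<le> u \<bullet> b"
  have le: "Re l \<le> Re u" "Im l \<le> Im u" using lu[of 1] lu[of \<i>] by (auto simp: Basis_complex_def)
  have "emeasure (distr (lborel \<Otimes>\<^sub>M lborel) borel (\<lambda>(x, y). Complex x y)) (box l u)
     = emeasure (lborel \<Otimes>\<^sub>M lborel) ({Re l<..<Re u} \<times> {Im l<..<Im u})"
    by (subst emeasure_distr)
       (auto simp: box_def Basis_complex_def space_pair_measure intro!: arg_cong[where f="emeasure _"])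
  also have "\<dots> = ennreal (Re u - Re l) * ennreal (Im u - Im l)"
    using le by (subst lborel.emeasure_pair_measure_Times) auto
  also have "\<dots> = ennreal (\<Prod>b\<in>Basis. (u - l) \<bullet> b)"
    using le by (simp add: Basis_complex_def ennreal_mult)
  finally show "emeasure (distr (lborel \<Otimes>\<^sub>M lborel) borel (\<lambda>(x, y). Complex x y)) (box l u)
    = (\<Prod>b\<in>Basis. (u - l) \<bullet> b)" .
qed simp

lemma nn_integral_complex_iterated:
  assumes [measurable]: "f \<in> borel_measurable borel"
  shows "(\<integral>\<^sup>+z. f z \<partial>lborel) = (\<integral>\<^sup>+x. \<integral>\<^sup>+y. f (Complex x y) \<partial>lborel \<partial>lborel)"
    and "(\<integral>\<^sup>+z. f z \<partial>lborel) = (\<integral>\<^sup>+y. \<integral>\<^sup>+x. f (Complex x y) \<partial>lborel \<partial>lborel)"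
proof -
  have [measurable]: "(\<lambda>(x, y). Complex x y) \<in> borel_measurable (borel \<Otimes>\<^sub>M borel)"
    unfolding borel_prod case_prod_beta
    by (intro borel_measurable_continuous_onI continuous_intros)
  have *: "(\<integral>\<^sup>+z. f z \<partial>lborel) = (\<integral>\<^sup>+p. f (Complex (fst p) (snd p)) \<partial>(lborel \<Otimes>\<^sub>M lborel))"
    by (subst lborel_complex_eq_distr_pair, subst nn_integral_distr) (auto simp: case_prod_beta)
  have [measurable]: "(\<lambda>p. f (Complex (fst p) (snd p))) \<in> borel_measurable (borel \<Otimes>\<^sub>M borel)"
    using measurable_compose[OF \<open>(\<lambda>(x, y). Complex x y) \<in> borel_measurable (borel \<Otimes>\<^sub>M borel)\<close> assms]
    by (simp add: case_prod_beta)
  show "(\<integral>\<^sup>+z. f z \<partial>lborel) = (\<integral>\<^sup>+x. \<integral>\<^sup>+y. f (Complex x y) \<partial>lborel \<partial>lborel)"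
    unfolding * by (subst lborel.nn_integral_fst[symmetric]) auto
  show "(\<integral>\<^sup>+z. f z \<partial>lborel) = (\<integral>\<^sup>+y. \<integral>\<^sup>+x. f (Complex x y) \<partial>lborel \<partial>lborel)"
    unfolding * by (subst lborel_pair.nn_integral_snd[symmetric]) auto
qed

lemma nn_integral_translate:
  assumes [measurable]: "f \<in> borel_measurable borel"
  shows "(\<integral>\<^sup>+x. f (x + c) \<partial>lborel) = (\<integral>\<^sup>+x. f x \<partial>(lborel :: real measure))"
proof -
  have "(\<integral>\<^sup>+x. f x \<partial>(lborel :: real measure)) = (\<integral>\<^sup>+x. f x \<partial>distr lborel borel ((+) c))"
    using lborel_distr_plus[of c] by simp
  also have "\<dots> = (\<integral>\<^sup>+x. f (x + c) \<partial>lborel)"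
    by (subst nn_integral_distr) (auto simp: add.commute)
  finally show ?thesis by simp
qed

text \<open>With the other coordinate fixed a shear is a translation, so it disappears in the inner
  integral once Fubini is used in the right order.\<close>

lemma nn_integral_shear:
  assumes [measurable]: "f \<in> borel_measurable borel"
  shows "(\<integral>\<^sup>+z. f (Complex (Re z + a * Im z) (Im z)) \<partial>lborel) = (\<integral>\<^sup>+z. f z \<partial>lborel)"
    and "(\<integral>\<^sup>+z. f (Complex (Re z) (Im z + a * Re z)) \<partial>lborel) = (\<integral>\<^sup>+z. f z \<partial>lborel)"
proof -
  have [measurable]: "(\<lambda>z. Complex (Re z + a * Im z) (Im z)) \<in> borel_measurable borel"
    "(\<lambda>z. Complex (Re z) (Im z + a * Re z)) \<in> borel_measurable borel"
    "\<And>y. (\<lambda>x. Complex x y) \<in> borel_measurable borel"  "\<And>y. (\<lambda>x. Complex y x) \<in> borel_measurable borel"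
    by (intro borel_measurable_continuous_onI continuous_intros)+
  show "(\<integral>\<^sup>+z. f (Complex (Re z + a * Im z) (Im z)) \<partial>lborel) = (\<integral>\<^sup>+z. f z \<partial>lborel)"
    by (subst (1 2) nn_integral_complex_iterated(2)) (auto simp: nn_integral_translate[of "\<lambda>x. f (Complex x y)" for y])
  show "(\<integral>\<^sup>+z. f (Complex (Re z) (Im z + a * Re z)) \<partial>lborel) = (\<integral>\<^sup>+z. f z \<partial>lborel)"
    by (subst (1 2) nn_integral_complex_iterated(1)) (auto simp: nn_integral_translate[of "\<lambda>y. f (Complex x y)" for x])
qed

text \<open>A rotation is a product of three shears.\<close>

lemma nn_integral_rotate:
  assumes [measurable]: "f \<in> borel_measurable borel" and "\<bar>t\<bar> < pi"
  shows "(\<integral>\<^sup>+z. f (cis t * z) \<partial>lborel) = (\<integral>\<^sup>+z. f z \<partial>lborel)"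
proof -
  \<comment> \<open>The product of the shears by \<open>a\<close>, \<open>sin t\<close> and
    \<open>a\<close> has diagonal entry \<open>1 + a * sin t\<close>. Equating it with
    \<open>cos t\<close> forces \<open>a = - tan (t / 2)\<close>, and \<open>|t| < pi\<close> keeps
    the tangent finite.\<close>
  define a where "a = - tan (t / 2)"
  have c: "cos (t / 2) > 0" using assms by (intro cos_gt_zero_pi) auto
  have 1: "1 + a * sin t = cos t"
    using sin_double[of "t/2"] cos_double_sin[of "t/2"] c by (simp add: a_def tan_def power2_eq_square)
  have 2: "a + a * cos t = - sin t"
  proof -
    have *: "1 + cos t = 2 * (cos (t / 2))\<^sup>2"
      using cos_double_cos[of "t/2"] by simp
    have "a + a * cos t = a * (1 + cos t)" by (simp add: algebra_simps)
    also have "\<dots> = a * (2 * (cos (t / 2))\<^sup>2)" unfolding * ..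
    also have "\<dots> = - sin t"
      using sin_double[of "t/2"] c by (simp add: a_def tan_def power2_eq_square)
    finally show ?thesis .
  qed
  have 3: "a + (1 + a * sin t) * a = - sin t" using 1 2 by (simp add: mult.commute)
  define S where "S b z = Complex (Re z + b * Im z) (Im z)" for b z
  define T where "T b z = Complex (Re z) (Im z + b * Re z)" for b z
  have [measurable]: "S b \<in> borel_measurable borel" "T b \<in> borel_measurable borel" for b
    unfolding S_def T_def by (intro borel_measurable_continuous_onI continuous_intros)+
  have r: "cis t * z = S a (T (sin t) (S a z))" for z
  proof (rule complex_eqI)
    have "Re (S a (T (sin t) (S a z))) = (1 + a * sin t) * Re z + (a + (1 + a * sin t) * a) * Im z"
      by (simp add: S_def T_def algebra_simps)
    thus "Re (cis t * z) = Re (S a (T (sin t) (S a z)))" unfolding 3 unfolding 1 by simp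
    have "Im (S a (T (sin t) (S a z))) = (1 + a * sin t) * Im z + sin t * Re z"
      by (simp add: S_def T_def algebra_simps)
    thus "Im (cis t * z) = Im (S a (T (sin t) (S a z)))" unfolding 1 by simp
  qed
  have S: "(\<integral>\<^sup>+z. h (S b z) \<partial>lborel) = (\<integral>\<^sup>+z. h z \<partial>lborel)"
    and T: "(\<integral>\<^sup>+z. h (T b z) \<partial>lborel) = (\<integral>\<^sup>+z. h z \<partial>lborel)"
    if "h \<in> borel_measurable borel" for h b
    using nn_integral_shear[OF that, of b] unfolding S_def T_def .
  have "(\<integral>\<^sup>+z. f (cis t * z) \<partial>lborel) = (\<integral>\<^sup>+z. f (S a (T (sin t) (S a z))) \<partial>lborel)"
    by (simp add: r)
  also have "\<dots> = (\<integral>\<^sup>+z. f (S a (T (sin t) z)) \<partial>lborel)"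
    by (rule S[of "\<lambda>z. f (S a (T (sin t) z))"]) measurable
  also have "\<dots> = (\<integral>\<^sup>+z. f (S a z) \<partial>lborel)"
    by (rule T[of "\<lambda>z. f (S a z)"]) measurable
  also have "\<dots> = (\<integral>\<^sup>+z. f z \<partial>lborel)"
    by (rule S) measurable
  finally show ?thesis .
qed

lemma distr_lborel_rotate:
  assumes "\<bar>t\<bar> < pi"
  shows "distr lborel borel (\<lambda>z. cis t * z) = (lborel :: complex measure)"
proof (rule measure_eqI)
  fix A assume "A \<in> sets (distr lborel borel (\<lambda>z. cis t * z))"
  hence [measurable]: "A \<in> sets borel" by simp
  have "emeasure (distr lborel borel (\<lambda>z. cis t * z)) A = (\<integral>\<^sup>+z. indicator A (cis t * z) \<partial>lborel)"
    by (subst nn_integral_indicator[symmetric], simp, subst nn_integral_distr) auto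
  also have "\<dots> = emeasure lborel A"
    using nn_integral_rotate[of "indicator A" t] assms by simp
  finally show "emeasure (distr lborel borel (\<lambda>z. cis t * z)) A = emeasure lborel A" .
qed simp

section \<open>Moments of the weighted measure\<close>

text \<open>This replaces polar coordinates: the disc of radius \<open>sqrt x\<close> has area
  \<open>pi * x\<close>, so both measures agree on the half-lines \<open>{x<..}\<close>, which
  determine a measure that is finite on them.\<close>

lemma distr_norm_square_disc:
  "distr (density lborel (indicator (ball 0 1))) borel (\<lambda>z::complex. (cmod z)\<^sup>2)
     = density lborel (\<lambda>x. ennreal pi * indicator {0..1} x)" (is "?M = ?N")
proof (rule measure_eqI_lessThan)
  have area: "emeasure lborel (cball (0::complex) r) = ennreal (pi * r\<^sup>2)"
    "emeasure lborel (ball (0::complex) r) = ennreal (pi * r\<^sup>2)" if "r \<ge> 0" for r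
    using that by (simp_all add: emeasure_cball emeasure_ball unit_ball_vol_2 power2_eq_square)
  have N: "emeasure ?N {x<..} = ennreal pi * emeasure lborel ({0..1} \<inter> {x<..})" for x
    by (subst emeasure_density) (auto simp: mult.assoc nn_integral_cmult indicator_inter_arith[symmetric])
  have [measurable]: "{z::complex. x < (cmod z)\<^sup>2} \<in> sets borel" for x by measurable
  have M: "emeasure ?M {x<..} = emeasure lborel (ball 0 1 \<inter> {z::complex. x < (cmod z)\<^sup>2})" for x
  proof -
    have "emeasure ?M {x<..} = emeasure (density lborel (indicator (ball 0 1))) {z::complex. x < (cmod z)\<^sup>2}"
      by (subst emeasure_distr) (auto simp: vimage_def)
    also have "\<dots> = (\<integral>\<^sup>+z. indicator (ball 0 1 \<inter> {z::complex. x < (cmod z)\<^sup>2}) z \<partial>lborel)"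
      unfolding indicator_inter_arith
      by (rule emeasure_density) (auto intro!: borel_measurable_indicator)
    also have "\<dots> = emeasure lborel (ball 0 1 \<inter> {z::complex. x < (cmod z)\<^sup>2})"
      by (rule nn_integral_indicator) simp
    finally show ?thesis .
  qed
  show eq: "emeasure ?M {x<..} = emeasure ?N {x<..}" for x
  proof -
    consider "x < 0" | "0 \<le> x" "x \<le> 1" | "x > 1" by linarith
    thus ?thesis
    proof cases
      case 1
      have "ball 0 1 \<inter> {z::complex. x < (cmod z)\<^sup>2} = ball 0 1" "{0..1} \<inter> {x<..} = {0..1}"
        using 1 by (auto intro: order.strict_trans2)
      thus ?thesis unfolding N M using area(2)[of 1] by simp
    next
      case 2
      have "ball 0 1 \<inter> {z::complex. x < (cmod z)\<^sup>2} = ball 0 1 - cball 0 (sqrt x)"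
        using 2 by (auto simp: not_le real_less_rsqrt) (metis not_le real_le_lsqrt norm_ge_zero real_sqrt_less_iff real_sqrt_abs abs_norm_cancel)+
      moreover have "emeasure lborel (ball 0 1 - cball (0::complex) (sqrt x)) = ennreal pi - ennreal (pi * x)"
      \<comment> \<open>For \<open>x = 1\<close> the closed disc is not contained in the open one,
        so the rule for the measure of a difference does not apply.\<close>
      proof (cases "x = 1")
        case True
        hence "ball 0 1 - cball (0::complex) (sqrt x) = {}" by auto
        thus ?thesis using True by (simp only: emeasure_empty) simp
      next
        case False
        hence "cball (0::complex) (sqrt x) \<subseteq> ball 0 1" using 2 by (auto simp: real_less_lsqrt order.strict_trans1)
        thus ?thesis using 2 area(1)[of "sqrt x"] area(2)[of 1]
          by (subst emeasure_Diff) auto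
      qed
      moreover have "{0..1} \<inter> {x<..} = {x<..1}" using 2 by auto
      ultimately show ?thesis unfolding N M using 2 by (simp add: ennreal_minus ennreal_mult'[symmetric] algebra_simps)
    next
      case 3
      have "\<not> x < (cmod z)\<^sup>2" if "cmod z < 1" for z
        using abs_square_less_1[of "cmod z"] that 3 by simp
      hence "ball 0 1 \<inter> {z::complex. x < (cmod z)\<^sup>2} = {}" "{0..1} \<inter> {x<..} = {}"
        using 3 by (auto dest: order.strict_trans)
      thus ?thesis unfolding N M by simp
    qed
  qed
  show "emeasure ?M {x<..} < \<infinity>" for x
  proof -
    have "emeasure ?M {x<..} \<le> emeasure lborel (ball (0::complex) 1)"
      unfolding M by (intro emeasure_mono) auto
    also have "\<dots> < \<infinity>" using area(2)[of 1] by simp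
    finally show ?thesis .
  qed
qed simp_all

text \<open>One coordinate factor of \<open>bergman_measure\<close>. The disc enters through an
  indicator and not through a restricted space, so that products over the coordinates are densities
  with respect to products of \<open>lborel\<close>.\<close>

definition disc_measure :: "nat \<Rightarrow> complex measure" where
  "disc_measure m = density lborel (\<lambda>z. ennreal ((real m - 1) / pi * (1 - (cmod z)\<^sup>2) ^ (m - 2)) * indicator (ball 0 1) z)"

lemma sets_disc_measure [simp, measurable_cong]: "sets (disc_measure m) = sets borel"
  and space_disc_measure [simp]: "space (disc_measure m) = UNIV"
  by (simp_all add: disc_measure_def)

text \<open>With \<open>x = |z|^2\<close> this is \<open>m - 1\<close> times the Beta integral at
  \<open>k + 1\<close> and \<open>m - 1\<close>. The value is the reciprocal of the count in
  \<open>cmod_coeff_power_le\<close>, read with \<open>m - 1\<close> in place of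
  \<open>m\<close>.\<close>

lemma nn_integral_norm_power_disc_measure:
  assumes m: "m \<ge> 2"
  shows "(\<integral>\<^sup>+z. ennreal (cmod z ^ (2 * k)) \<partial>disc_measure m) = ennreal (1 / real ((k + (m - 1)) choose (m - 1)))"
proof -
  define h where "h x = (real m - 1) / pi * (1 - x) ^ (m - 2) * x ^ k" for x :: real
  have [measurable]: "h \<in> borel_measurable borel" unfolding h_def by measurable
  have [measurable]: "ball (0::complex) 1 \<in> sets borel" by simp
  have "(\<integral>\<^sup>+z. ennreal (cmod z ^ (2 * k)) \<partial>disc_measure m)
     = (\<integral>\<^sup>+z. indicator (ball 0 1) z * ennreal (h ((cmod z)\<^sup>2)) \<partial>lborel)"
    unfolding disc_measure_def
  proof (subst nn_integral_density)
    show "(\<integral>\<^sup>+ x. ennreal ((real m - 1) / pi * (1 - (cmod x)\<^sup>2) ^ (m - 2)) * indicator (ball 0 1) x * ennreal (cmod x ^ (2 * k)) \<partial>lborel) =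
    (\<integral>\<^sup>+ z. indicator (ball 0 1) z * ennreal (h ((cmod z)\<^sup>2)) \<partial>lborel)"
      using m by (intro nn_integral_cong)
        (auto simp: h_def ennreal_mult''[symmetric] power_mult split: split_indicator)
  qed measurable
  also have "\<dots> = (\<integral>\<^sup>+x. ennreal (h x) \<partial>distr (density lborel (indicator (ball 0 1))) borel (\<lambda>z::complex. (cmod z)\<^sup>2))"
    by (subst nn_integral_distr) (auto simp: nn_integral_density)
  also have "\<dots> = (\<integral>\<^sup>+x. ennreal pi * indicator {0..1} x * ennreal (h x) \<partial>lborel)"
    unfolding distr_norm_square_disc by (subst nn_integral_density) auto
  also have "\<dots> = (\<integral>\<^sup>+x. ennreal (indicator {0<..<1} x * ((real m - 1) * (x powr (real (Suc k) - 1) * (1 - x) powr (real (m - 1) - 1)))) \<partial>lborel)"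
  proof (rule nn_integral_cong_AE)
    \<comment> \<open>The endpoints form a null set, and the open interval avoids them because there
      \<open>0 powr 0 = 0\<close> would differ from \<open>0 ^ 0 = 1\<close>.\<close>
    have "AE x in lborel. x \<noteq> (0::real)" "AE x in lborel. x \<noteq> (1::real)" by (rule AE_lborel_singleton)+
    thus "AE x in lborel. ennreal pi * indicator {0..1} x * ennreal (h x) = ennreal (indicator {0<..<1} x * ((real m - 1) * (x powr (real (Suc k) - 1) * (1 - x) powr (real (m - 1) - 1))))"
    proof eventually_elim
      case (elim x)
      show ?case
      proof (cases "x \<in> {0<..<1}")
        case True
        have "real (m - 1) - 1 = real (m - 2)" using m by (simp add: of_nat_diff)
        hence "(1 - x) powr (real (m - 1) - 1) = (1 - x) ^ (m - 2)" "x powr (real (Suc k) - 1) = x ^ k"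
          using True powr_realpow[of "1 - x" "m - 2"] by (simp_all only: ) (simp_all add: powr_realpow)
        thus ?thesis using True by (simp add: h_def ennreal_mult'[symmetric] mult_ac)
      qed (use elim in auto)
    qed
  qed
  also have "\<dots> = ennreal ((real m - 1) * Beta (real (Suc k)) (real (m - 1)))"
  proof (rule nn_integral_has_integral_lborel)
    have "((\<lambda>x. (real m - 1) * (x powr (real (Suc k) - 1) * (1 - x) powr (real (m - 1) - 1))) has_integral
        (real m - 1) * Beta (real (Suc k)) (real (m - 1))) {0<..<1}"
      using has_integral_mult_right[OF has_integral_Beta_real[of "real (Suc k)" "real (m - 1)"], of "real m - 1"] m
      by (simp add: has_integral_Icc_iff_Ioo)
    thus "((\<lambda>x. indicator {0<..<1} x * ((real m - 1) * (x powr (real (Suc k) - 1) * (1 - x) powr (real (m - 1) - 1)))) has_integral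
        (real m - 1) * Beta (real (Suc k)) (real (m - 1))) UNIV"
      using has_integral_restrict_UNIV[of "{0<..<1}", THEN iffD2] unfolding indicator_def
      by (subst (asm) has_integral_restrict_UNIV[symmetric]) (auto elim!: has_integral_eq_rhs has_integral_eq[rotated])
  qed (use m in auto)
  also have "(real m - 1) * Beta (real (Suc k)) (real (m - 1)) = 1 / real ((k + (m - 1)) choose (m - 1))"
  proof -
    obtain l where l: "m = Suc (Suc l)" using m by (metis Suc_1 Suc_le_D numeral_2_eq_2 Suc_le_mono)
    have "real (Suc k) + real (Suc l) = 1 + real (Suc (k + l))" by simp
    hence "Beta (real (Suc k)) (real (Suc l)) = fact k * fact l / fact (Suc (k + l))"
      unfolding Beta_def using Gamma_fact[of k, where ?'a = real] Gamma_fact[of l, where ?'a = real] Gamma_fact[of "Suc (k+l)", where ?'a = real]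
      by (simp add: add_ac)
    moreover have "real ((k + Suc l) choose (Suc l)) = fact (Suc (k + l)) / (fact k * fact (Suc l))"
      using binomial_fact[of "Suc l" "k + Suc l", where ?'a = real] by (simp add: mult_ac)
    ultimately show ?thesis unfolding l by (simp add: field_simps)
  qed
  finally show ?thesis .
qed

lemma prob_space_disc_measure:
  assumes "m \<ge> 2"
  shows "prob_space (disc_measure m)"
  using nn_integral_norm_power_disc_measure[OF assms, of 0] by (intro prob_spaceI) simp

lemma AE_disc_measure: "AE z in disc_measure m. cmod z < 1"
  unfolding disc_measure_def
  by (subst AE_density) (auto simp: indicator_def borel_measurable_indicator split: if_splits)

lemma distr_disc_measure_rotate:
  assumes "\<bar>t\<bar> < pi"
  shows "distr (disc_measure m) borel (\<lambda>z. cis t * z) = disc_measure m"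
proof -
  define d where "d z = ennreal ((real m - 1) / pi * (1 - (cmod z)\<^sup>2) ^ (m - 2)) * indicator (ball 0 1) z" for z :: complex
  have [measurable]: "ball (0::complex) 1 \<in> sets borel" by simp
  have [measurable]: "d \<in> borel_measurable borel" unfolding d_def by measurable
  have "disc_measure m = density (distr lborel borel (\<lambda>z. cis t * z)) d"
    unfolding distr_lborel_rotate[OF assms] by (simp add: disc_measure_def d_def[abs_def])
  also have "\<dots> = distr (density lborel (\<lambda>z. d (cis t * z))) borel (\<lambda>z. cis t * z)"
    by (rule density_distr) measurable
  also have "density lborel (\<lambda>z. d (cis t * z)) = disc_measure m"
    by (simp add: disc_measure_def d_def norm_mult indicator_def)
  finally show ?thesis ..
qed

section \<open>Orthogonality of monomials on the disc\<close>

lemma integrable_bounded_disc_measure: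
  fixes f :: "complex \<Rightarrow> 'a::{banach, second_countable_topology}"
  assumes "m \<ge> 2" "f \<in> borel_measurable borel" "\<And>z. cmod z < 1 \<Longrightarrow> norm (f z) \<le> B"
  shows "integrable (disc_measure m) f"
proof -
  interpret prob_space "disc_measure m" by (rule prob_space_disc_measure) fact
  show ?thesis
    using AE_disc_measure[of m] assms(2,3)
    by (intro integrable_const_bound[of _ B]) (auto elim!: eventually_mono simp: measurable_def)
qed

lemma integrable_monomial_disc_measure:
  assumes "m \<ge> 2"
  shows "integrable (disc_measure m) (\<lambda>z. z ^ j * cnj z ^ k)"
proof (rule integrable_bounded_disc_measure[where B=1])
  show "(\<lambda>z. z ^ j * cnj z ^ k) \<in> borel_measurable borel"
    by (intro borel_measurable_continuous_onI continuous_intros)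
  show "cmod (z ^ j * cnj z ^ k) \<le> 1" if "cmod z < 1" for z
    using that by (simp add: norm_mult norm_power mult_le_one power_le_one)
qed fact

lemma integral_monomial_disc_measure:
  assumes m: "m \<ge> 2"
  shows "(LINT z|disc_measure m. z ^ j * cnj z ^ k)
     = (if j = k then of_real (1 / real ((k + (m - 1)) choose (m - 1))) else 0)"
proof (cases "j = k")
  case True
  have "(LINT z|disc_measure m. z ^ k * cnj z ^ k) = (LINT z|disc_measure m. of_real (cmod z ^ (2 * k)))"
    by (intro Bochner_Integration.integral_cong)
      (simp_all only: power_mult complex_norm_square[symmetric] power_mult_distrib[symmetric] of_real_power)
  also have "\<dots> = of_real (LINT z|disc_measure m. cmod z ^ (2 * k))"
    by (rule integral_complex_of_real)
  also have "(LINT z|disc_measure m. cmod z ^ (2 * k)) = 1 / real ((k + (m - 1)) choose (m - 1))"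
    by (subst integral_eq_nn_integral) (auto simp: nn_integral_norm_power_disc_measure[OF m])
  finally show ?thesis using True by simp
next
  case False
  define I where "I = (LINT z|disc_measure m. z ^ j * cnj z ^ k)"
  define d where "d = real j - real k"
  \<comment> \<open>Rotating by \<open>t\<close> multiplies the monomial by
    \<open>cis (d * t)\<close>, and this choice makes the factor the imaginary unit, so rotation
    invariance gives \<open>I = \<i> * I\<close>. As \<open>d\<close> is a nonzero integer,
    \<open>t\<close> is within the range of \<open>distr_disc_measure_rotate\<close>.\<close>
  define t where "t = pi / (2 * d)"
  have d: "\<bar>d\<bar> \<ge> 1" using False unfolding d_def by linarith
  have "\<bar>t\<bar> = pi / (2 * \<bar>d\<bar>)" by (simp add: t_def abs_mult)
  also have "\<dots> \<le> pi / 2" using d by (intro divide_left_mono) auto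
  finally have t: "\<bar>t\<bar> < pi" using pi_gt_zero by linarith
  have meas: "(\<lambda>z. z ^ j * cnj z ^ k) \<in> borel_measurable borel"
    by (intro borel_measurable_continuous_onI continuous_intros)
  have "I = (LINT z|distr (disc_measure m) borel (\<lambda>z. cis t * z). z ^ j * cnj z ^ k)"
    unfolding distr_disc_measure_rotate[OF t] I_def ..
  also have "\<dots> = (LINT z|disc_measure m. (cis t * z) ^ j * cnj (cis t * z) ^ k)"
    by (rule integral_distr[OF _ meas]) simp
  also have "\<dots> = (LINT z|disc_measure m. (cis t ^ j * cnj (cis t) ^ k) * (z ^ j * cnj z ^ k))"
    by (simp add: power_mult_distrib mult_ac)
  also have "\<dots> = (cis t ^ j * cnj (cis t) ^ k) * I" unfolding I_def by simp
  also have "cis t ^ j * cnj (cis t) ^ k = cis (d * t)"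
    by (simp add: cis_cnj Complex.DeMoivre cis_mult d_def algebra_simps)
  also have "d * t = pi / 2" using d by (auto simp: t_def)
  finally have "I = \<i> * I" by simp
  hence "I = 0" by (metis Im_i_times Re_i_times add_eq_0_iff2 complex_eqI equation_minus_iff neg_equal_zero zero_complex.simps)
  thus ?thesis using False unfolding I_def by simp
qed

lemma integral_poly_disc_measure:
  assumes m: "m \<ge> 2"
  shows "(LINT z|disc_measure m. poly q z) = coeff q 0"
proof -
  have "(LINT z|disc_measure m. poly q z) = (LINT z|disc_measure m. (\<Sum>i\<le>degree q. coeff q i * (z ^ i * cnj z ^ 0)))"
    by (simp add: poly_altdef)
  also have "\<dots> = (\<Sum>i\<le>degree q. coeff q i * (LINT z|disc_measure m. z ^ i * cnj z ^ 0))"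
    by (subst Bochner_Integration.integral_sum)
       (simp_all only: integral_mult_right_zero integrable_mult_right integrable_monomial_disc_measure[OF m])
  also have "\<dots> = coeff q 0"
    unfolding integral_monomial_disc_measure[OF m] by (simp add: if_distrib sum.delta cong: if_cong)
  finally show ?thesis .
qed

lemma integral_norm_poly_square_disc_measure:
  assumes m: "m \<ge> 2"
  shows "(LINT z|disc_measure m. (cmod (poly q z))\<^sup>2)
     = (\<Sum>k\<le>degree q. (cmod (coeff q k))\<^sup>2 / real ((k + (m - 1)) choose (m - 1)))"
proof -
  have "complex_of_real (LINT z|disc_measure m. (cmod (poly q z))\<^sup>2)
     = (LINT z|disc_measure m. poly q z * cnj (poly q z))"
    by (simp only: integral_complex_of_real[symmetric] complex_norm_square)
  also have "\<dots> = (LINT z|disc_measure m. (\<Sum>i\<le>degree q. \<Sum>k\<le>degree q. coeff q i * cnj (coeff q k) * (z ^ i * cnj z ^ k)))"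
    by (simp add: poly_altdef sum_product mult_ac)
  also have "\<dots> = (\<Sum>i\<le>degree q. \<Sum>k\<le>degree q. coeff q i * cnj (coeff q k) * (LINT z|disc_measure m. z ^ i * cnj z ^ k))"
    using integrable_monomial_disc_measure[OF m] by simp
  also have "\<dots> = (\<Sum>i\<le>degree q. coeff q i * cnj (coeff q i) * of_real (1 / real ((i + (m - 1)) choose (m - 1))))"
    unfolding integral_monomial_disc_measure[OF m] by (simp add: if_distrib sum.delta cong: if_cong)
  also have "\<dots> = of_real (\<Sum>k\<le>degree q. (cmod (coeff q k))\<^sup>2 / real ((k + (m - 1)) choose (m - 1)))"
    by (simp add: complex_norm_square[symmetric] del: of_real_power)
  finally show ?thesis by (simp only: of_real_eq_iff)
qed

section \<open>The one-variable estimate for polynomials\<close>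

text \<open>Superadditivity of the m-th power on nonnegative reals, for the splitting
  \<open>2 * s = (2 * s - t) + t\<close>. The induction step only uses that both summands are at
  most \<open>2 * s\<close>.\<close>

lemma two_square_minus_power_le:
  fixes s t :: real
  assumes "0 \<le> t" "t \<le> s" "m \<ge> 1"
  shows "(2 * s - t) ^ m + t ^ m \<le> (2 * s) ^ m"
  using assms(3)
proof (induction m rule: nat_induct_at_least)
  case (Suc m)
  have "(2 * s - t) ^ Suc m + t ^ Suc m \<le> (2 * s) * (2 * s - t) ^ m + (2 * s) * t ^ m"
    using assms by (auto intro!: add_mono mult_right_mono)
  also have "\<dots> = 2 * s * ((2 * s - t) ^ m + t ^ m)" by (simp add: algebra_simps)
  also have "\<dots> \<le> 2 * s * (2 * s) ^ m" using assms Suc by (intro mult_left_mono) auto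
  finally show ?case by simp
qed simp

text \<open>\<open>a\<close> and \<open>S\<close> stand for the mean and the mean square of a
  boundary function whose Fourier partial sum on the circle is the real part of \<open>q\<close>;
  the last hypothesis will come from \<open>bessel_herglotz\<close>. For polynomials all coefficient
  sums are finite and all integrands bounded on the disc.\<close>

lemma nn_integral_Re_poly_power_le:
  fixes q :: "complex poly" and S :: real
  assumes m: "m \<ge> 2" and 0: "coeff q 0 = of_real a" and a: "a\<^sup>2 \<le> S"
    and S: "poly (norm2_poly q) 1 \<le> 2 * S - a\<^sup>2"
  shows "(\<integral>\<^sup>+z. ennreal (Re (poly q z) ^ (2 * m)) \<partial>disc_measure m) \<le> ennreal (D_const m ^ (2 * m) * S ^ m)"
proof -
  define s where "s = pi / (4 * real m)"
  interpret prob_space "disc_measure m" by (rule prob_space_disc_measure) fact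
  have s: "0 < s" "s \<le> pi / 4" using m pi_gt_zero by (auto simp: s_def field_simps)
  have cs: "cos s > 0" using s by (intro cos_gt_zero_pi) auto
  have tan1: "tan s \<le> 1"
    using tan_mono_le[of s "pi/4"] s by (simp add: tan_45)
  have cont: "f \<in> borel_measurable borel" if "continuous_on UNIV f" for f :: "complex \<Rightarrow> real"
    using that by (rule borel_measurable_continuous_onI)
  have bnd: "\<exists>B. \<forall>z. cmod z < 1 \<longrightarrow> norm (f z) \<le> B" if "continuous_on UNIV f" for f :: "complex \<Rightarrow> real"
  proof -
    have "compact (f ` cball 0 1)"
      by (intro compact_continuous_image continuous_on_subset[OF that]) auto
    then obtain B where "\<forall>x\<in>f ` cball 0 1. norm x \<le> B" using compact_imp_bounded bounded_iff by metis
    thus ?thesis by (intro exI[of _ B]) auto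
  qed
  have int: "integrable (disc_measure m) f" if "continuous_on UNIV f" for f :: "complex \<Rightarrow> real"
    using bnd[OF that] cont[OF that] integrable_bounded_disc_measure[OF m, of f] by blast
  have i1: "integrable (disc_measure m) (\<lambda>z. Re (poly q z) ^ (2 * m))"
    and i2: "integrable (disc_measure m) (\<lambda>z. cmod (poly q z) ^ (2 * m))"
    and i3: "integrable (disc_measure m) (\<lambda>z. Re (poly q z ^ (2 * m)))"
    by (intro int continuous_intros)+
  have "(\<integral>\<^sup>+z. ennreal (Re (poly q z) ^ (2 * m)) \<partial>disc_measure m)
     = ennreal (LINT z|disc_measure m. Re (poly q z) ^ (2 * m))"
    by (rule nn_integral_eq_integral[OF i1]) simp
  also have "(LINT z|disc_measure m. Re (poly q z) ^ (2 * m)) \<le> D_const m ^ (2 * m) * S ^ m"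
  proof -
    have "(LINT z|disc_measure m. Re (poly q z) ^ (2 * m))
        \<le> (LINT z|disc_measure m. cos s ^ (2 * m) * (cmod (poly q z) ^ (2 * m) + tan s * Re (poly q z ^ (2 * m))))"
      using m unfolding s_def
      by (intro integral_mono i1 Re_power_le integrable_mult_right Bochner_Integration.integrable_add i2 i3) simp
    also have "\<dots> = cos s ^ (2 * m) * ((LINT z|disc_measure m. cmod (poly q z) ^ (2 * m))
        + tan s * (LINT z|disc_measure m. Re (poly q z ^ (2 * m))))"
      using i2 i3 by simp
    \<comment> \<open>Since \<open>|q|^(2m) = |q^m|^2\<close>, orthogonality reads the integral off
      the coefficients of \<open>q ^ m\<close>.\<close>
    also have "(LINT z|disc_measure m. cmod (poly q z) ^ (2 * m)) = (LINT z|disc_measure m. (cmod (poly (q ^ m) z))\<^sup>2)"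
      by (simp add: poly_power norm_power power_mult[symmetric] mult.commute)
    also have "\<dots> = (\<Sum>k\<le>degree (q ^ m). (cmod (coeff (q ^ m) k))\<^sup>2 / real ((k + (m - 1)) choose (m - 1)))"
      by (rule integral_norm_poly_square_disc_measure[OF m])
    also have "(LINT z|disc_measure m. Re (poly q z ^ (2 * m))) = a ^ (2 * m)"
    proof -
      have "continuous_on UNIV (\<lambda>z. cmod (poly (q ^ (2 * m)) z))" by (intro continuous_intros)
      from bnd[OF this] obtain B where B: "\<forall>z. cmod z < 1 \<longrightarrow> norm (cmod (poly (q ^ (2 * m)) z)) \<le> B" ..
      have "integrable (disc_measure m) (\<lambda>z. poly (q ^ (2 * m)) z)"
      proof (rule integrable_bounded_disc_measure[OF m, where B=B])
        show "(\<lambda>z. poly (q ^ (2 * m)) z) \<in> borel_measurable borel"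
          by (intro borel_measurable_continuous_onI continuous_intros)
        show "cmod z < 1 \<Longrightarrow> norm (poly (q ^ (2 * m)) z) \<le> B" for z using B by simp
      qed
      hence "(LINT z|disc_measure m. Re (poly (q ^ (2 * m)) z)) = Re (coeff (q ^ (2 * m)) 0)"
        by (simp only: integral_Re integral_poly_disc_measure[OF m])
      thus ?thesis by (simp add: poly_power coeff_0_power 0)
    qed
    also have "(\<Sum>k\<le>degree (q ^ m). (cmod (coeff (q ^ m) k))\<^sup>2 / real ((k + (m - 1)) choose (m - 1)))
       \<le> poly (norm2_poly q) 1 ^ m"
      using sum_cmod_coeff_power_le[of q "m - 1"] m by simp
    also have "poly (norm2_poly q) 1 ^ m \<le> (2 * S - a\<^sup>2) ^ m"
      using S by (intro power_mono) (simp_all add: poly_1_eq_sum_coeff sum_nonneg)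
    \<comment> \<open>Only \<open>tan s <= 1\<close> is kept, because a full \<open>a^(2m)\<close>
      fits under \<open>(2 * S)^m\<close> next to \<open>(2 * S - a^2)^m\<close>.\<close>
    also have "tan s * a ^ (2 * m) \<le> 1 * (a\<^sup>2) ^ m"
      unfolding power_mult by (intro mult_right_mono tan1) simp
    also have "(2 * S - a\<^sup>2) ^ m + 1 * (a\<^sup>2) ^ m \<le> (2 * S) ^ m"
      using two_square_minus_power_le[of "a\<^sup>2" S m] a m by simp
    also have "cos s ^ (2 * m) * (2 * S) ^ m = D_const m ^ (2 * m) * S ^ m"
    proof -
      have "(D_const m)\<^sup>2 = 2 * (cos s)\<^sup>2" by (simp add: D_const_def s_def power_mult_distrib)
      thus ?thesis unfolding power_mult by (simp add: power_mult_distrib mult_ac)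
    qed
    finally show ?thesis using cs by (simp add: mult_left_mono)
  qed
  finally show ?thesis by (simp add: ennreal_leI)
qed

section \<open>The Poisson integral\<close>

definition angle_measure :: "real measure" where
  "angle_measure = uniform_measure lborel {0..<2 * pi}"

lemma sets_angle_measure [simp, measurable_cong]: "sets angle_measure = sets borel"
  and space_angle_measure [simp]: "space angle_measure = UNIV"
  by (simp_all add: angle_measure_def)

lemma prob_space_angle_measure: "prob_space angle_measure"
  unfolding angle_measure_def by (rule prob_space_uniform_measure) auto

interpretation angle: prob_space angle_measure by (rule prob_space_angle_measure)

lemma cis_measurable [measurable]: "cis \<in> borel_measurable borel"
  by (intro borel_measurable_continuous_onI continuous_on_cis continuous_on_id)

lemma continuous_on_circle_comp:
  assumes "continuous_on (sphere 0 1) f"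
  shows "continuous_on S (\<lambda>t. f (cis t))"
proof (rule continuous_on_compose2[OF assms])
  show "continuous_on S cis" by (intro continuous_on_cis continuous_on_id)
qed auto

lemma borel_measurable_circle_comp [measurable (raw)]:
  assumes "continuous_on (sphere 0 1) (f :: complex \<Rightarrow> 'a :: topological_space)"
  shows "(\<lambda>t. f (cis t)) \<in> borel_measurable borel"
  using continuous_on_circle_comp[OF assms] by (rule borel_measurable_continuous_onI)

lemma integrable_circle:
  fixes f :: "complex \<Rightarrow> 'a::{banach, second_countable_topology}"
  assumes "continuous_on (sphere 0 1) f"
  shows "integrable angle_measure (\<lambda>t. f (cis t))"
proof -
  have "compact (f ` sphere 0 1)" by (intro compact_continuous_image assms) auto
  then obtain B where "\<forall>x\<in>f ` sphere 0 1. norm x \<le> B" using compact_imp_bounded bounded_iff by metis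
  thus ?thesis using borel_measurable_circle_comp[OF assms]
    by (intro angle.integrable_const_bound[of _ B]) (auto simp: measurable_def)
qed

lemma integral_angle_measure:
  fixes f :: "real \<Rightarrow> complex"
  assumes "continuous_on UNIV f"
  shows "(LINT t|angle_measure. f t) = integral {0..2 * pi} f / (2 * pi)"
proof -
  have [measurable]: "f \<in> borel_measurable borel" using assms by (rule borel_measurable_continuous_onI)
  have e: "angle_measure = density lborel (\<lambda>t. ennreal (indicator {0..<2 * pi} t / (2 * pi)))"
    unfolding angle_measure_def uniform_measure_def
    by (intro density_cong) (auto simp: divide_ennreal[symmetric] ennreal_indicator split: split_indicator)
  have "(LINT t|angle_measure. f t) = (LINT t|lborel. (indicator {0..<2 * pi} t / (2 * pi)) *\<^sub>R f t)"
    unfolding e by (rule integral_density) auto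
  also have "\<dots> = (LINT t|lborel. (indicator {0..2 * pi} t *\<^sub>R f t) / (2 * pi))"
  proof (rule integral_cong_AE)
    have "AE t in lborel. t \<noteq> 2 * pi" by (rule AE_lborel_singleton)
    thus "AE t in lborel. (indicator {0..<2 * pi} t / (2 * pi)) *\<^sub>R f t = (indicator {0..2 * pi} t *\<^sub>R f t) / (2 * pi)"
      by eventually_elim (auto simp: indicator_def scaleR_conv_of_real)
  qed measurable
  also have "\<dots> = (LINT t:{0..2*pi}|lborel. f t) / (2 * pi)"
    unfolding set_lebesgue_integral_def by simp
  also have "(LINT t:{0..2*pi}|lborel. f t) = integral {0..2 * pi} f"
    by (intro set_borel_integral_eq_integral borel_integrable_atLeastAtMost' continuous_on_subset[OF assms]) auto
  finally show ?thesis .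
qed

section \<open>The Poisson kernel and the Poisson formula\<close>

text \<open>Written as the real part of the Herglotz kernel, so that integrating a real function
  against it visibly gives the real part of a holomorphic function; \<open>poisson_kernel_eq\<close>
  recovers the usual form on the circle.\<close>

definition poisson_kernel :: "complex \<Rightarrow> complex \<Rightarrow> real" where
  "poisson_kernel z w = Re ((w + z) / (w - z))"

lemma poisson_kernel_eq:
  assumes "cmod w = 1"
  shows "poisson_kernel z w = (1 - (cmod z)\<^sup>2) / (cmod (w - z))\<^sup>2"
proof -
  have "Re ((w + z) / (w - z)) = Re ((w + z) * cnj (w - z)) / (cmod (w - z))\<^sup>2"
    by (subst complex_div_cnj) simp
  also have "Re ((w + z) * cnj (w - z)) = (cmod w)\<^sup>2 - (cmod z)\<^sup>2"
    unfolding cmod_power2 by (simp add: power2_eq_square algebra_simps)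
  finally show ?thesis using assms by (simp add: poisson_kernel_def)
qed

lemma poisson_kernel_nonneg: "cmod w = 1 \<Longrightarrow> cmod z < 1 \<Longrightarrow> poisson_kernel z w \<ge> 0"
  using abs_square_le_1[of "cmod z"] by (simp add: poisson_kernel_eq)

lemma continuous_on_poisson_kernel [continuous_intros]:
  assumes "cmod z < 1"
  shows "continuous_on (sphere 0 1) (poisson_kernel z)"
  unfolding poisson_kernel_def using assms by (intro continuous_intros) auto

text \<open>Cauchy's formula for \<open>w \<mapsto> G w (1 - |z|\<^sup>2) / (1 - z\<^sup>* w)\<close> at the point \<open>z\<close>.\<close>

lemma poisson_formula_holomorphic:
  assumes cont: "continuous_on (cball 0 1) G" and hol: "G holomorphic_on ball 0 1" and z: "cmod z < 1"
  shows "(LINT t|angle_measure. of_real (poisson_kernel z (cis t)) * G (cis t)) = G z"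
proof -
  define E where "E w = G w * of_real (1 - (cmod z)\<^sup>2) / (1 - cnj z * w)" for w
  have nz: "1 - cnj z * w \<noteq> 0" if "cmod w \<le> 1" for w
  proof
    assume "1 - cnj z * w = 0"
    hence "cmod (cnj z * w) = 1" by (metis eq_iff_diff_eq_0 norm_one)
    moreover have "cmod z * cmod w \<le> cmod z * 1" using that by (intro mult_left_mono) auto
    ultimately show False using z by (simp add: norm_mult)
  qed
  have "((\<lambda>w. E w / (w - z)) has_contour_integral (2 * of_real pi * \<i> * E z)) (circlepath 0 1)"
  proof (rule Cauchy_integral_circlepath)
    show "continuous_on (cball 0 1) E" unfolding E_def using nz by (intro continuous_intros cont) auto
    show "E holomorphic_on ball 0 1" unfolding E_def using nz by (intro holomorphic_intros hol) auto
  qed (use z in auto)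
  also have "E z = G z"
  proof -
    have "1 - cnj z * z = of_real (1 - (cmod z)\<^sup>2)" by (simp only: of_real_diff of_real_1 complex_norm_square mult.commute)
    thus ?thesis unfolding E_def using nz[of z] z by simp
  qed
  finally have "((\<lambda>t. E (cis t) / (cis t - z) * \<i> * cis t) has_integral (2 * of_real pi * \<i> * G z)) {0..2 * pi}"
    unfolding circlepath_def by (subst (asm) has_contour_integral_part_circlepath_iff) auto
  hence "((\<lambda>t. - \<i> * (E (cis t) / (cis t - z) * \<i> * cis t)) has_integral (- \<i> * (2 * of_real pi * \<i> * G z))) {0..2 * pi}"
    by (rule has_integral_mult_right)
  hence "((\<lambda>t. E (cis t) / (cis t - z) * cis t) has_integral 2 * of_real pi * G z) {0..2 * pi}"
    by (simp add: mult_ac)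
  hence 1: "integral {0..2 * pi} (\<lambda>t. E (cis t) / (cis t - z) * cis t) = 2 * of_real pi * G z"
    by (rule integral_unique)
  have *: "a / D / d * c = a / N" if "N * c = d * D" "c \<noteq> 0" for a D d c N :: complex
  proof -
    have "a / D / d * c = a * (c / (d * D))" by (simp add: mult_ac)
    also have "\<dots> = a / N" unfolding that(1)[symmetric] using that(2) by simp
    finally show ?thesis .
  qed
  \<comment> \<open>On the circle \<open>cnj w = 1 / w\<close>, so the denominators satisfy
    \<open>(w - z) * (1 - cnj z * w) = |w - z|^2 * w\<close>. The Cauchy kernel times
    \<open>w\<close> thus turns into the Poisson kernel.\<close>
  have 2: "E (cis t) / (cis t - z) * cis t = of_real (poisson_kernel z (cis t)) * G (cis t)" for t
  proof -
    have "cnj (cis t - z) * cis t = 1 - cnj z * cis t"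
      by (simp add: left_diff_distrib cis_cnj cis_mult)
    hence "of_real ((cmod (cis t - z))\<^sup>2) * cis t = (cis t - z) * (1 - cnj z * cis t)"
      by (simp only: complex_norm_square mult.assoc)
    hence "E (cis t) / (cis t - z) * cis t = G (cis t) * of_real (1 - (cmod z)\<^sup>2) / of_real ((cmod (cis t - z))\<^sup>2)"
      unfolding E_def by (intro *) auto
    thus ?thesis by (simp add: poisson_kernel_eq)
  qed
  have "continuous_on (sphere 0 1) (\<lambda>w. of_real (poisson_kernel z w) * G w)"
    using z by (intro continuous_intros continuous_on_subset[OF cont]) auto
  hence "(LINT t|angle_measure. of_real (poisson_kernel z (cis t)) * G (cis t)) =
     integral {0..2 * pi} (\<lambda>t. of_real (poisson_kernel z (cis t)) * G (cis t)) / (2 * pi)"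
    by (intro integral_angle_measure continuous_on_circle_comp[of "\<lambda>w. of_real (poisson_kernel z w) * G w"])
  also have "\<dots> = G z" using 1 unfolding 2 by simp
  finally show ?thesis .
qed

lemma integral_poisson_kernel:
  assumes "cmod z < 1"
  shows "(LINT t|angle_measure. poisson_kernel z (cis t)) = 1"
proof -
  have "complex_of_real (LINT t|angle_measure. poisson_kernel z (cis t)) = 1"
    using poisson_formula_holomorphic[of "\<lambda>_. 1" z] assms by simp
  thus ?thesis by simp
qed

section \<open>Orthogonality of monomials on the circle\<close>

text \<open>The Poisson kernel at 0 is constantly 1, so this is the Poisson formula for
  \<open>w ^ k\<close> at the centre.\<close>

lemma integral_circle_power: "(LINT t|angle_measure. cis t ^ k) = (if k = 0 then 1 else 0)"
proof -
  have "poisson_kernel 0 (cis t) = 1" for t by (simp add: poisson_kernel_eq)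
  moreover have "(LINT t|angle_measure. of_real (poisson_kernel 0 (cis t)) * cis t ^ k) = 0 ^ k"
    by (rule poisson_formula_holomorphic) (auto intro!: continuous_intros holomorphic_intros)
  ultimately show ?thesis by (simp add: power_0_left)
qed

lemma integral_circle_monomial:
  "(LINT t|angle_measure. cis t ^ j * cnj (cis t) ^ k) = (if j = k then 1 else 0)"
proof -
  have le: "(LINT t|angle_measure. cis t ^ j * cnj (cis t) ^ k) = (if j = k then 1 else 0)" if "k \<le> j" for j k
  proof -
    have "cis t ^ j * cnj (cis t) ^ k = cis t ^ (j - k)" for t
    proof -
      have "cis t ^ j * cnj (cis t) ^ k = cis t ^ (j - k) * (cis t * cnj (cis t)) ^ k"
        using that by (simp only: power_mult_distrib mult.assoc[symmetric] power_add[symmetric]) simp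
      thus ?thesis by (simp add: cis_cnj cis_mult)
    qed
    thus ?thesis using that by (simp add: integral_circle_power)
  qed
  show ?thesis
  proof (cases "k \<le> j")
    case False
    have "(LINT t|angle_measure. cis t ^ j * cnj (cis t) ^ k) = (LINT t|angle_measure. cnj (cis t ^ k * cnj (cis t) ^ j))"
      by (simp add: mult.commute)
    also have "\<dots> = cnj (LINT t|angle_measure. cis t ^ k * cnj (cis t) ^ j)" by (rule Bochner_Integration.integral_cnj)
    finally show ?thesis using le[of j k] False by simp
  qed (rule le)
qed

lemma integral_circle_poly: "(LINT t|angle_measure. poly q (cis t)) = coeff q 0"
proof -
  have int: "integrable angle_measure (\<lambda>t. coeff q i * cis t ^ i)" for i
    by (rule integrable_circle[of "\<lambda>w. coeff q i * w ^ i"]) (intro continuous_intros)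
  have "(LINT t|angle_measure. poly q (cis t)) = (\<Sum>i\<le>degree q. LINT t|angle_measure. coeff q i * cis t ^ i)"
    unfolding poly_altdef by (rule Bochner_Integration.integral_sum[OF int])
  also have "\<dots> = (\<Sum>i\<le>degree q. coeff q i * (if i = 0 then 1 else 0))"
    by (simp only: integral_mult_right_zero integral_circle_power)
  also have "\<dots> = coeff q 0" by (simp add: if_distrib sum.delta cong: if_cong)
  finally show ?thesis .
qed

lemma integral_circle_norm_poly_square:
  "(LINT t|angle_measure. (cmod (poly q (cis t)))\<^sup>2) = (\<Sum>k\<le>degree q. (cmod (coeff q k))\<^sup>2)"
proof -
  have int: "integrable angle_measure (\<lambda>t. cis t ^ i * cnj (cis t) ^ k)" for i k
    by (rule integrable_circle[of "\<lambda>w. w ^ i * cnj w ^ k"]) (intro continuous_intros)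
  have "complex_of_real (LINT t|angle_measure. (cmod (poly q (cis t)))\<^sup>2)
     = (LINT t|angle_measure. poly q (cis t) * cnj (poly q (cis t)))"
    by (simp only: integral_complex_of_real[symmetric] complex_norm_square)
  also have "\<dots> = (LINT t|angle_measure. (\<Sum>i\<le>degree q. \<Sum>k\<le>degree q. coeff q i * cnj (coeff q k) * (cis t ^ i * cnj (cis t) ^ k)))"
    by (simp add: poly_altdef sum_product mult_ac)
  also have "\<dots> = (\<Sum>i\<le>degree q. \<Sum>k\<le>degree q. coeff q i * cnj (coeff q k) * (LINT t|angle_measure. cis t ^ i * cnj (cis t) ^ k))"
    using int by simp
  also have "\<dots> = (\<Sum>i\<le>degree q. coeff q i * cnj (coeff q i))"
    unfolding integral_circle_monomial by (simp add: if_distrib sum.delta cong: if_cong)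
  also have "\<dots> = of_real (\<Sum>k\<le>degree q. (cmod (coeff q k))\<^sup>2)"
    by (simp add: complex_norm_square[symmetric] del: of_real_power)
  finally show ?thesis by (simp only: of_real_eq_iff)
qed

text \<open>Taylor polynomials of the Herglotz integral of \<open>\<phi>\<close>; their real parts on the circle are
  the partial sums of the Fourier series of \<open>\<phi>\<close>.\<close>

definition herglotz_coeff :: "(complex \<Rightarrow> real) \<Rightarrow> nat \<Rightarrow> complex" where
  "herglotz_coeff \<phi> k = (if k = 0 then 1 else 2) * (LINT t|angle_measure. of_real (\<phi> (cis t)) * cnj (cis t) ^ k)"

definition herglotz_poly :: "(complex \<Rightarrow> real) \<Rightarrow> nat \<Rightarrow> complex poly" where
  "herglotz_poly \<phi> n = (\<Sum>k\<le>n. monom (herglotz_coeff \<phi> k) k)"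

lemma coeff_herglotz_poly: "coeff (herglotz_poly \<phi> n) k = (if k \<le> n then herglotz_coeff \<phi> k else 0)"
  unfolding herglotz_poly_def by (simp add: coeff_sum sum.delta)

lemma degree_herglotz_poly: "degree (herglotz_poly \<phi> n) \<le> n"
  by (rule degree_le) (simp add: coeff_herglotz_poly)

lemma herglotz_coeff_0: "herglotz_coeff \<phi> 0 = of_real (LINT t|angle_measure. \<phi> (cis t))"
  by (simp add: herglotz_coeff_def)

lemma sum_degree_eq:
  assumes "degree q \<le> n" "f 0 = (0::'b::comm_monoid_add)"
  shows "(\<Sum>k\<le>degree q. f (coeff q k)) = (\<Sum>k\<le>n. f (coeff q k))"
  using assms by (intro sum.mono_neutral_left) (auto simp: coeff_eq_0)

section \<open>Bessel's inequality and convergence of the Taylor polynomials\<close>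

text \<open>On the circle \<open>Re q\<close> is the orthogonal projection of \<open>\<phi>\<close>
  to the trigonometric polynomials of degree at most \<open>n\<close>, so
  \<open>\<phi> * Re q\<close> and \<open>(Re q)^2\<close> have the same mean
  \<open>(T + a^2) / 2\<close>. Expanding the mean of \<open>(\<phi> - Re q)^2\<close>, which is
  nonnegative, leaves \<open>(T + a^2) / 2\<close> below the mean of
  \<open>\<phi>^2\<close>.\<close>

lemma bessel_herglotz:
  assumes \<phi>: "continuous_on (sphere 0 1) \<phi>"
  shows "poly (norm2_poly (herglotz_poly \<phi> n)) 1
     \<le> 2 * (LINT t|angle_measure. (\<phi> (cis t))\<^sup>2) - (LINT t|angle_measure. \<phi> (cis t))\<^sup>2"
proof -
  define q where "q = herglotz_poly \<phi> n"
  define a where "a = (LINT t|angle_measure. \<phi> (cis t))"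
  define T where "T = (\<Sum>k\<le>n. (cmod (herglotz_coeff \<phi> k))\<^sup>2)"
  have dq: "degree q \<le> n" unfolding q_def by (rule degree_herglotz_poly)
  have int: "integrable angle_measure (\<lambda>t. f (cis t))" if "continuous_on (sphere 0 1) f"
    for f :: "complex \<Rightarrow> 'a::{banach, second_countable_topology}" using that by (rule integrable_circle)
  have T1: "poly (norm2_poly q) 1 = T"
  proof -
    have "degree (norm2_poly q) \<le> n"
      by (rule degree_le) (use dq in \<open>simp add: coeff_eq_0\<close>)
    from sum_degree_eq[OF this, of "\<lambda>x. x"] show ?thesis
      by (simp add: poly_1_eq_sum_coeff T_def q_def coeff_herglotz_poly)
  qed
  have T2: "(LINT t|angle_measure. (cmod (poly q (cis t)))\<^sup>2) = T"
    using sum_degree_eq[OF dq, of "\<lambda>x. (cmod x)\<^sup>2"]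
    by (simp add: integral_circle_norm_poly_square T_def q_def coeff_herglotz_poly)
  have sq: "(LINT t|angle_measure. Re ((poly q (cis t))\<^sup>2)) = a\<^sup>2"
  proof -
    have "(LINT t|angle_measure. Re (poly (q\<^sup>2) (cis t))) = Re (coeff (q\<^sup>2) 0)"
      unfolding integral_circle_poly[symmetric]
      by (rule integral_Re) (rule int, intro continuous_intros)
    moreover have "coeff (q\<^sup>2) 0 = of_real (a\<^sup>2)"
      by (simp add: coeff_0_power q_def coeff_herglotz_poly herglotz_coeff_0 a_def)
    ultimately show ?thesis by (simp only: poly_power Re_complex_of_real)
  qed
  \<comment> \<open>Uses \<open>(Re w)^2 = (|w|^2 + Re (w^2)) / 2\<close>; the mean of
    \<open>q^2\<close> is its constant coefficient.\<close>
  have Re2: "(LINT t|angle_measure. (Re (poly q (cis t)))\<^sup>2) = (T + a\<^sup>2) / 2"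
  proof -
    have "(LINT t|angle_measure. (Re (poly q (cis t)))\<^sup>2)
      = (LINT t|angle_measure. ((cmod (poly q (cis t)))\<^sup>2 + Re ((poly q (cis t))\<^sup>2)) / 2)"
      unfolding cmod_power2 by (simp add: power2_eq_square)
    also have "\<dots> = ((LINT t|angle_measure. (cmod (poly q (cis t)))\<^sup>2) + (LINT t|angle_measure. Re ((poly q (cis t))\<^sup>2))) / 2"
      using int[of "\<lambda>w. (cmod (poly q w))\<^sup>2"] int[of "\<lambda>w. Re ((poly q w)\<^sup>2)"]
      by (simp add: continuous_intros)
    finally show ?thesis unfolding T2 sq .
  qed
  \<comment> \<open>The factor 2 in \<open>herglotz_coeff\<close> halves the terms with
    \<open>k > 0\<close>. The constant term has no such factor and leaves the additional
    \<open>a^2 / 2\<close>.\<close>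
  have cross: "(LINT t|angle_measure. \<phi> (cis t) * Re (poly q (cis t))) = (T + a\<^sup>2) / 2"
  proof -
    have i: "integrable angle_measure (\<lambda>t. herglotz_coeff \<phi> k * (of_real (\<phi> (cis t)) * cis t ^ k))" for k
      by (rule int[of "\<lambda>w. herglotz_coeff \<phi> k * (of_real (\<phi> w) * w ^ k)"]) (intro continuous_intros \<phi>)
    have c: "(LINT t|angle_measure. of_real (\<phi> (cis t)) * cis t ^ k) = cnj (herglotz_coeff \<phi> k) / (if k = 0 then 1 else 2)" for k
    proof -
      have "cnj (LINT t|angle_measure. of_real (\<phi> (cis t)) * cnj (cis t) ^ k) = (LINT t|angle_measure. cnj (of_real (\<phi> (cis t)) * cnj (cis t) ^ k))"
        by (rule Bochner_Integration.integral_cnj[symmetric])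
      thus ?thesis by (simp add: herglotz_coeff_def)
    qed
    have "(LINT t|angle_measure. of_real (\<phi> (cis t)) * poly q (cis t))
       = (LINT t|angle_measure. (\<Sum>k\<le>n. herglotz_coeff \<phi> k * (of_real (\<phi> (cis t)) * cis t ^ k)))"
      unfolding q_def herglotz_poly_def by (simp add: poly_sum poly_monom sum_distrib_left mult_ac)
    also have "\<dots> = (\<Sum>k\<le>n. herglotz_coeff \<phi> k * (LINT t|angle_measure. of_real (\<phi> (cis t)) * cis t ^ k))"
      by (subst Bochner_Integration.integral_sum[OF i]) (simp only: integral_mult_right_zero)
    also have "\<dots> = (\<Sum>k\<le>n. of_real ((cmod (herglotz_coeff \<phi> k))\<^sup>2 / (if k = 0 then 1 else 2)))"
      unfolding c by (intro sum.cong) (simp_all add: complex_norm_square del: of_real_power)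
    also have "\<dots> = of_real (\<Sum>k\<le>n. (cmod (herglotz_coeff \<phi> k))\<^sup>2 / (if k = 0 then 1 else 2))" by simp
    also have "(\<Sum>k\<le>n. (cmod (herglotz_coeff \<phi> k))\<^sup>2 / (if k = 0 then 1 else 2)) =
      (\<Sum>k\<le>n. (cmod (herglotz_coeff \<phi> k))\<^sup>2 / 2 + (if k = 0 then a\<^sup>2 / 2 else 0))"
      by (intro sum.cong) (auto simp: herglotz_coeff_0 a_def)
    also have "\<dots> = (T + a\<^sup>2) / 2"
      by (simp add: sum.distrib T_def sum_divide_distrib add_divide_distrib sum.delta)
    finally have "(LINT t|angle_measure. of_real (\<phi> (cis t)) * poly q (cis t)) = of_real ((T + a\<^sup>2) / 2)" .
    moreover have "(LINT t|angle_measure. Re (of_real (\<phi> (cis t)) * poly q (cis t)))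
        = Re (LINT t|angle_measure. of_real (\<phi> (cis t)) * poly q (cis t))"
      by (intro integral_Re int[of "\<lambda>w. of_real (\<phi> w) * poly q w"] continuous_intros \<phi>)
    ultimately have "(LINT t|angle_measure. Re (of_real (\<phi> (cis t)) * poly q (cis t))) = (T + a\<^sup>2) / 2"
      by (simp only: Re_complex_of_real)
    thus ?thesis by simp
  qed
  have "0 \<le> (LINT t|angle_measure. (\<phi> (cis t) - Re (poly q (cis t)))\<^sup>2)" by simp
  also have "\<dots> = (LINT t|angle_measure. (\<phi> (cis t))\<^sup>2 - 2 * (\<phi> (cis t) * Re (poly q (cis t))) + (Re (poly q (cis t)))\<^sup>2)"
    by (simp add: power2_diff algebra_simps)
  also have "\<dots> = (LINT t|angle_measure. (\<phi> (cis t))\<^sup>2) - 2 * (LINT t|angle_measure. \<phi> (cis t) * Re (poly q (cis t)))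
      + (LINT t|angle_measure. (Re (poly q (cis t)))\<^sup>2)"
    using int[of "\<lambda>w. (\<phi> w)\<^sup>2"] int[of "\<lambda>w. \<phi> w * Re (poly q w)"] int[of "\<lambda>w. (Re (poly q w))\<^sup>2"]
    by (simp add: continuous_intros \<phi>)
  finally show ?thesis unfolding cross Re2 T1[unfolded q_def] a_def[symmetric] by (simp add: field_simps)
qed

text \<open>At \<open>z\<close> the polynomial is the integral of \<open>\<phi>\<close> against
  \<open>S n x\<close> with \<open>x = z * cnj w\<close>. These are the partial sums of
  \<open>(1 + x) / (1 - x)\<close>, which on the circle is the Herglotz kernel
  \<open>(w + z) / (w - z)\<close>, and the geometric series in \<open>|z|\<close> dominates
  them.\<close>

lemma herglotz_poly_tendsto:
  assumes \<phi>: "continuous_on (sphere 0 1) \<phi>" and z: "cmod z < 1"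
  shows "(\<lambda>n. Re (poly (herglotz_poly \<phi> n) z)) \<longlonglongrightarrow> (LINT t|angle_measure. poisson_kernel z (cis t) * \<phi> (cis t))"
proof -
  define S where "S n x = 2 * (\<Sum>k\<le>n. x ^ k) - 1" for n and x :: complex
  have poly: "poly (herglotz_poly \<phi> n) z = (LINT t|angle_measure. of_real (\<phi> (cis t)) * S n (z * cnj (cis t)))" for n
  proof -
    have i: "integrable angle_measure (\<lambda>t. z ^ k * (if k = 0 then 1 else 2) * (of_real (\<phi> (cis t)) * cnj (cis t) ^ k))" for k
      by (rule integrable_circle[of "\<lambda>w. z ^ k * (if k = 0 then 1 else 2) * (of_real (\<phi> w) * cnj w ^ k)"]) (intro continuous_intros \<phi>)
    have S: "S n x = (\<Sum>k\<le>n. (if k = 0 then 1 else 2) * x ^ k)" for x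
      unfolding S_def by (induction n) (auto simp: algebra_simps)
    have "poly (herglotz_poly \<phi> n) z = (\<Sum>k\<le>n. z ^ k * (if k = 0 then 1 else 2) * (LINT t|angle_measure. of_real (\<phi> (cis t)) * cnj (cis t) ^ k))"
      by (simp add: herglotz_poly_def herglotz_coeff_def poly_sum poly_monom mult_ac)
    also have "\<dots> = (LINT t|angle_measure. (\<Sum>k\<le>n. z ^ k * (if k = 0 then 1 else 2) * (of_real (\<phi> (cis t)) * cnj (cis t) ^ k)))"
      by (subst Bochner_Integration.integral_sum[OF i]) (simp only: integral_mult_right_zero)
    also have "\<dots> = (LINT t|angle_measure. of_real (\<phi> (cis t)) * S n (z * cnj (cis t)))"
      unfolding S by (simp only: sum_distrib_left power_mult_distrib mult_ac)
    finally show ?thesis .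
  qed
  have "(\<lambda>n. LINT t|angle_measure. of_real (\<phi> (cis t)) * S n (z * cnj (cis t)))
     \<longlonglongrightarrow> (LINT t|angle_measure. of_real (\<phi> (cis t)) * ((cis t + z) / (cis t - z)))"
  proof (rule integral_dominated_convergence[where w="\<lambda>t. \<bar>\<phi> (cis t)\<bar> * (2 * (1 / (1 - cmod z)) + 1)"])
    show "integrable angle_measure (\<lambda>t. \<bar>\<phi> (cis t)\<bar> * (2 * (1 / (1 - cmod z)) + 1))"
      by (rule integrable_circle[of "\<lambda>w. \<bar>\<phi> w\<bar> * (2 * (1 / (1 - cmod z)) + 1)"]) (intro continuous_intros \<phi>)
    show "AE t in angle_measure. (\<lambda>n. of_real (\<phi> (cis t)) * S n (z * cnj (cis t))) \<longlonglongrightarrow> of_real (\<phi> (cis t)) * ((cis t + z) / (cis t - z))"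
    proof (rule AE_I2, rule tendsto_mult_left)
      fix t
      define x where "x = z * cnj (cis t)"
      have x: "cmod x < 1" using z by (simp add: x_def norm_mult)
      have "(\<lambda>n. \<Sum>k\<le>n. x ^ k) \<longlonglongrightarrow> 1 / (1 - x)"
        using geometric_sums[OF x] unfolding sums_def_le .
      hence "(\<lambda>n. S n x) \<longlonglongrightarrow> 2 * (1 / (1 - x)) - 1" unfolding S_def by (intro tendsto_intros)
      also have "2 * (1 / (1 - x)) - 1 = (1 + x) / (1 - x)"
      proof -
        have "1 - x \<noteq> 0" using x by auto
        thus ?thesis by (simp add: field_simps)
      qed
      also have "\<dots> = (cis t * (1 + x)) / (cis t * (1 - x))" by simp
      also have "\<dots> = (cis t + z) / (cis t - z)"
        by (simp add: x_def algebra_simps cis_cnj) (simp add: mult.left_commute[of _ z] cis_mult)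
      finally show "(\<lambda>n. S n (z * cnj (cis t))) \<longlonglongrightarrow> (cis t + z) / (cis t - z)" unfolding x_def .
    qed
    show "AE t in angle_measure. cmod (of_real (\<phi> (cis t)) * S n (z * cnj (cis t))) \<le> \<bar>\<phi> (cis t)\<bar> * (2 * (1 / (1 - cmod z)) + 1)" for n
    proof (rule AE_I2)
      fix t
      define x where "x = z * cnj (cis t)"
      have x: "cmod x = cmod z" by (simp add: x_def norm_mult)
      have "cmod (\<Sum>k\<le>n. x ^ k) \<le> (\<Sum>k\<le>n. cmod z ^ k)"
        by (rule order_trans[OF norm_sum]) (simp add: norm_power x)
      also have "\<dots> \<le> (\<Sum>k. cmod z ^ k)" using z by (intro sum_le_suminf summable_geometric) auto
      also have "\<dots> = 1 / (1 - cmod z)" using z by (intro suminf_geometric) simp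
      finally have "cmod (S n x) \<le> 2 * (1 / (1 - cmod z)) + 1"
        unfolding S_def by (intro order_trans[OF norm_triangle_ineq4]) (simp add: norm_mult)
      thus "cmod (of_real (\<phi> (cis t)) * S n (z * cnj (cis t))) \<le> \<bar>\<phi> (cis t)\<bar> * (2 * (1 / (1 - cmod z)) + 1)"
        unfolding x_def[symmetric] by (simp only: norm_mult norm_of_real) (intro mult_left_mono, auto)
    qed
    have "(\<lambda>t. of_real (\<phi> (cis t)) * S n (z * cnj (cis t))) \<in> borel_measurable borel" for n
      unfolding S_def
      by (rule borel_measurable_circle_comp[of "\<lambda>w. of_real (\<phi> w) * (2 * (\<Sum>k\<le>n. (z * cnj w) ^ k) - 1)"]) (intro continuous_intros \<phi>)
    thus "(\<lambda>t. of_real (\<phi> (cis t)) * S n (z * cnj (cis t))) \<in> borel_measurable angle_measure" for n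
      by (simp add: measurable_def)
    have "(\<lambda>t. of_real (\<phi> (cis t)) * ((cis t + z) / (cis t - z))) \<in> borel_measurable borel"
      using z by (intro borel_measurable_circle_comp[of "\<lambda>w. of_real (\<phi> w) * ((w + z) / (w - z))"] continuous_intros \<phi>) auto
    thus "(\<lambda>t. of_real (\<phi> (cis t)) * ((cis t + z) / (cis t - z))) \<in> borel_measurable angle_measure"
      by (simp add: measurable_def)
  qed
  hence "(\<lambda>n. Re (poly (herglotz_poly \<phi> n) z)) \<longlonglongrightarrow> Re (LINT t|angle_measure. of_real (\<phi> (cis t)) * ((cis t + z) / (cis t - z)))"
    unfolding poly by (rule tendsto_Re)
  also have "Re (LINT t|angle_measure. of_real (\<phi> (cis t)) * ((cis t + z) / (cis t - z)))
     = (LINT t|angle_measure. Re (of_real (\<phi> (cis t)) * ((cis t + z) / (cis t - z))))"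
    using z by (intro integral_Re[symmetric] integrable_circle[of "\<lambda>w. of_real (\<phi> w) * ((w + z) / (w - z))"] continuous_intros \<phi>) auto
  also have "\<dots> = (LINT t|angle_measure. poisson_kernel z (cis t) * \<phi> (cis t))"
  proof -
    have "Re (of_real c * x) = Re x * c" for c x by simp
    thus ?thesis by (simp only: poisson_kernel_def)
  qed
  finally show ?thesis .
qed

section \<open>The one-variable estimate for sub-Poisson functions\<close>

text \<open>The bound for the Taylor polynomials does not depend on their degree and their real
  parts converge to the Poisson integral of \<open>g\<close>, so Fatou's lemma applies. The real
  parts may be negative, which the even exponent absorbs.\<close>

lemma nn_integral_sub_poisson_power_le:
  fixes g :: "complex \<Rightarrow> real"
  assumes m: "m \<ge> 2" and g: "continuous_on (sphere 0 1) g" "\<And>z. g z \<ge> 0"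
    and sub: "\<And>z. cmod z < 1 \<Longrightarrow> g z \<le> (LINT t|angle_measure. poisson_kernel z (cis t) * g (cis t))"
  shows "(\<integral>\<^sup>+z. ennreal (g z ^ (2 * m)) \<partial>disc_measure m)
     \<le> ennreal (D_const m ^ (2 * m) * (LINT t|angle_measure. (g (cis t))\<^sup>2) ^ m)"
proof -
  define a where "a = (LINT t|angle_measure. g (cis t))"
  define S where "S = (LINT t|angle_measure. (g (cis t))\<^sup>2)"
  define u where "u n z = ennreal (Re (poly (herglotz_poly g n) z) ^ (2 * m))" for n z
  have a: "a\<^sup>2 \<le> S"
  proof -
    have "angle.variance (\<lambda>t. g (cis t)) \<ge> 0" by simp
    thus ?thesis unfolding a_def S_def
      using integrable_circle[OF g(1)] integrable_circle[of "\<lambda>w. (g w)\<^sup>2"] g(1)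
      by (subst (asm) angle.variance_eq) (auto intro!: continuous_intros)
  qed
  have u: "(\<integral>\<^sup>+z. u n z \<partial>disc_measure m) \<le> ennreal (D_const m ^ (2 * m) * S ^ m)" for n
    unfolding u_def
    by (rule nn_integral_Re_poly_power_le[OF m _ a])
       (use bessel_herglotz[OF g(1)] in \<open>simp_all add: coeff_herglotz_poly herglotz_coeff_0 a_def S_def\<close>)
  have u_meas: "u n \<in> borel_measurable (disc_measure m)" for n
  proof -
    have [measurable]: "(\<lambda>z. Re (poly (herglotz_poly g n) z) ^ (2 * m)) \<in> borel_measurable borel"
      by (intro borel_measurable_continuous_onI continuous_intros)
    show ?thesis unfolding u_def by measurable
  qed
  have "(\<integral>\<^sup>+z. ennreal (g z ^ (2 * m)) \<partial>disc_measure m) \<le> (\<integral>\<^sup>+z. liminf (\<lambda>n. u n z) \<partial>disc_measure m)"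
  proof (rule nn_integral_mono_AE)
    show "AE z in disc_measure m. ennreal (g z ^ (2 * m)) \<le> liminf (\<lambda>n. u n z)"
      using AE_disc_measure
    proof eventually_elim
      case (elim z)
      have "(\<lambda>n. u n z) \<longlonglongrightarrow> ennreal ((LINT t|angle_measure. poisson_kernel z (cis t) * g (cis t)) ^ (2 * m))"
        unfolding u_def by (intro tendsto_ennrealI tendsto_power herglotz_poly_tendsto g(1) elim)
      hence "liminf (\<lambda>n. u n z) = ennreal ((LINT t|angle_measure. poisson_kernel z (cis t) * g (cis t)) ^ (2 * m))"
        by (intro lim_imp_Liminf) auto
      also have "\<dots> \<ge> ennreal (g z ^ (2 * m))"
        by (intro ennreal_leI power_mono sub elim g(2))
      finally show ?case .
    qed
  qed
  also have "\<dots> \<le> liminf (\<lambda>n. \<integral>\<^sup>+z. u n z \<partial>disc_measure m)"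
    by (rule nn_integral_liminf[OF u_meas])
  also have "\<dots> \<le> liminf (\<lambda>n. ennreal (D_const m ^ (2 * m) * S ^ m))"
    by (intro Liminf_mono always_eventually allI u)
  also have "\<dots> = ennreal (D_const m ^ (2 * m) * S ^ m)" by (simp add: Liminf_const)
  finally show ?thesis unfolding S_def .
qed

section \<open>Tensorization\<close>

text \<open>Convexity of the power \<open>n + 1\<close>, with the tangent taken at \<open>s\<close>;
  choosing \<open>s\<close> well yields the Hoelder inequality below from a pointwise bound.\<close>

lemma power_above_tangent:
  fixes s t :: real
  assumes "s \<ge> 0" "t \<ge> 0"
  shows "real (Suc n) * t * s ^ n \<le> t ^ Suc n + real n * s ^ Suc n"
proof (induction n)
  case (Suc n)
  have "0 \<le> (t - s) * (t ^ Suc n - s ^ Suc n)"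
  proof (cases "s \<le> t")
    case True
    thus ?thesis using assms by (intro mult_nonneg_nonneg) (auto simp del: power_Suc intro: power_mono)
  next
    case False
    thus ?thesis using assms by (intro mult_nonpos_nonpos) (auto simp del: power_Suc intro: power_mono)
  qed
  moreover have "s * (real (Suc n) * t * s ^ n) \<le> s * (t ^ Suc n + real n * s ^ Suc n)"
    using Suc assms by (intro mult_left_mono)
  ultimately show ?case by (simp add: algebra_simps)
qed simp

text \<open>Jensen for the power \<open>n + 1\<close>, applied to \<open>\<psi> / c\<close> under
  the probability density \<open>c / C\<close>; the tangent point \<open>s\<close> is the mean of
  \<open>\<psi> / c\<close> under that density. The lower bound \<open>\<epsilon>\<close> keeps the
  quotients bounded and hence integrable.\<close>

lemma (in prob_space) expectation_power_le_weighted: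
  fixes \<psi> c :: "'a \<Rightarrow> real"
  assumes \<psi>: "\<psi> \<in> borel_measurable M" "\<And>w. 0 \<le> \<psi> w" "\<And>w. \<psi> w \<le> B"
    and c: "integrable M c" "\<And>w. w \<in> space M \<Longrightarrow> c w \<ge> \<epsilon>" and \<epsilon>: "\<epsilon> > 0"
  shows "expectation \<psi> ^ Suc n \<le> expectation c ^ n * expectation (\<lambda>w. \<psi> w ^ Suc n / c w ^ n)"
proof -
  define C where "C = expectation c"
  define s where "s = expectation \<psi> / C"
  have "\<epsilon> \<le> C"
    using integral_ge_const[OF c(1), of \<epsilon>] c(2) unfolding C_def by auto
  hence C: "C > 0" using \<epsilon> by simp
  have s: "s \<ge> 0" unfolding s_def using C \<psi>(2) by simp
  have c0: "c w > 0" if "w \<in> space M" for w using c(2)[OF that] \<epsilon> by simp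
  have [measurable]: "\<psi> \<in> borel_measurable M" "c \<in> borel_measurable M"
    using \<psi>(1) c(1) by auto
  have B: "B \<ge> 0" using \<psi>(2,3) order_trans by blast
  have i1: "integrable M \<psi>"
    using \<psi> by (intro integrable_const_bound[of _ B]) auto
  have i2: "integrable M (\<lambda>w. \<psi> w ^ Suc n / c w ^ n)"
  proof (rule integrable_const_bound[of _ "B ^ Suc n / \<epsilon> ^ n"])
    have "\<bar>\<psi> w ^ Suc n / c w ^ n\<bar> \<le> B ^ Suc n / \<epsilon> ^ n" if "w \<in> space M" for w
    proof -
      have "\<psi> w ^ Suc n / c w ^ n \<le> B ^ Suc n / \<epsilon> ^ n"
        using \<psi>(2,3) c(2)[OF that] \<epsilon> B by (intro frac_le power_mono) auto
      thus ?thesis using \<psi>(2)[of w] c0[OF that] by simp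
    qed
    thus "AE w in M. norm (\<psi> w ^ Suc n / c w ^ n) \<le> B ^ Suc n / \<epsilon> ^ n" by auto
  qed measurable
  have pw: "real (Suc n) * s ^ n * \<psi> w \<le> \<psi> w ^ Suc n / c w ^ n + real n * s ^ Suc n * c w" if "w \<in> space M" for w
  proof -
    have "real (Suc n) * (\<psi> w / c w) * s ^ n \<le> (\<psi> w / c w) ^ Suc n + real n * s ^ Suc n"
      using s \<psi>(2)[of w] c0[OF that] by (intro power_above_tangent) auto
    from mult_right_mono[OF this, of "c w"]
    have "real (Suc n) * (\<psi> w / c w) * s ^ n * c w \<le> ((\<psi> w / c w) ^ Suc n + real n * s ^ Suc n) * c w"
      using c0[OF that] by simp
    moreover have "real (Suc n) * (\<psi> w / c w) * s ^ n * c w = real (Suc n) * s ^ n * \<psi> w"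
      using c0[OF that] by simp
    moreover have "((\<psi> w / c w) ^ Suc n + real n * s ^ Suc n) * c w = \<psi> w ^ Suc n / c w ^ n + real n * s ^ Suc n * c w"
      using c0[OF that] by (simp add: power_divide distrib_right)
    ultimately show ?thesis by simp
  qed
  have "real (Suc n) * s ^ n * expectation \<psi> = expectation (\<lambda>w. real (Suc n) * s ^ n * \<psi> w)" by simp
  also have "\<dots> \<le> expectation (\<lambda>w. \<psi> w ^ Suc n / c w ^ n + real n * s ^ Suc n * c w)"
    using i1 i2 c(1) pw by (intro integral_mono) auto
  also have "\<dots> = expectation (\<lambda>w. \<psi> w ^ Suc n / c w ^ n) + real n * s ^ Suc n * C"
    using i2 c(1) by (simp add: C_def)
  finally have "s ^ Suc n * C \<le> expectation (\<lambda>w. \<psi> w ^ Suc n / c w ^ n)"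
  proof -
    assume *: "real (Suc n) * s ^ n * expectation \<psi> \<le> expectation (\<lambda>w. \<psi> w ^ Suc n / c w ^ n) + real n * s ^ Suc n * C"
    have "expectation \<psi> = s * C" using C by (simp add: s_def)
    with * show ?thesis by (simp add: algebra_simps)
  qed
  hence "C ^ n * (s ^ Suc n * C) \<le> C ^ n * expectation (\<lambda>w. \<psi> w ^ Suc n / c w ^ n)"
    using C by (intro mult_left_mono) auto
  moreover have "C ^ n * (s ^ Suc n * C) = expectation \<psi> ^ Suc n"
    using C by (simp add: s_def power_divide)
  ultimately show ?thesis unfolding C_def by simp
qed

text \<open>Minkowski's integral inequality in \<open>L\<^sup>m\<close>, with \<open>c w\<close> in the place of the norm of
  \<open>\<lambda>x. \<psi> x w\<close>.\<close>

lemma minkowski_integral_power: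
  fixes \<psi> :: "'a \<Rightarrow> 'b \<Rightarrow> real" and c :: "'b \<Rightarrow> real"
  assumes "sigma_finite_measure M" "prob_space N"
    and \<psi>: "case_prod \<psi> \<in> borel_measurable (M \<Otimes>\<^sub>M N)" "\<And>x w. 0 \<le> \<psi> x w" "\<And>x w. \<psi> x w \<le> B"
    and c: "integrable N c" "\<And>w. 0 \<le> c w"
    and le: "\<And>w. w \<in> space N \<Longrightarrow> (\<integral>\<^sup>+x. ennreal (\<psi> x w ^ m) \<partial>M) \<le> ennreal (c w ^ m)"
    and m: "m \<ge> 1"
  shows "(\<integral>\<^sup>+x. ennreal ((LINT w|N. \<psi> x w) ^ m) \<partial>M) \<le> ennreal ((LINT w|N. c w) ^ m)"
proof -
  interpret M: sigma_finite_measure M by fact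
  interpret N: prob_space N by fact
  interpret pair_sigma_finite M N ..
  obtain n where n: "m = Suc n" using m by (cases m) auto
  have [measurable]: "case_prod \<psi> \<in> borel_measurable (M \<Otimes>\<^sub>M N)" "c \<in> borel_measurable N"
    using \<psi>(1) c(1) by auto
  have [measurable]: "\<psi> x \<in> borel_measurable N" if "x \<in> space M" for x
    using measurable_Pair2[OF \<psi>(1) that] by simp
  define K where "K = (LINT w|N. c w)"
  have K: "K \<ge> 0" unfolding K_def using c(2) by simp
  define X where "X = (\<integral>\<^sup>+x. ennreal ((LINT w|N. \<psi> x w) ^ m) \<partial>M)"
  have B: "B \<ge> 0" using \<psi>(2,3) order_trans by blast
  have eps: "X \<le> ennreal ((K + \<epsilon>) ^ m)" if \<epsilon>: "\<epsilon> > 0" for \<epsilon>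
  proof -
    \<comment> \<open>The weighted inequality divides by the weight and \<open>c\<close> may vanish,
      so it is used with \<open>c + \<epsilon>\<close>, and \<open>\<epsilon>\<close> tends to 0 at
      the end.\<close>
    define d where "d w = c w + \<epsilon>" for w
    have d: "d w \<ge> \<epsilon>" "d w > 0" for w using c(2)[of w] \<epsilon> by (auto simp: d_def)
    have int_d: "integrable N d" unfolding d_def using c(1) by simp
    have [measurable]: "d \<in> borel_measurable N" using int_d by auto
    have Ed: "(LINT w|N. d w) = K + \<epsilon>" unfolding d_def K_def using c(1) by (simp add: N.prob_space)
    have "X \<le> (\<integral>\<^sup>+x. ennreal ((K + \<epsilon>) ^ n) * (\<integral>\<^sup>+w. ennreal (\<psi> x w ^ m / d w ^ n) \<partial>N) \<partial>M)"
      unfolding X_def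
    proof (rule nn_integral_mono)
      fix x assume [simp]: "x \<in> space M"
      have bnd: "norm (\<psi> x w ^ m / d w ^ n) \<le> B ^ m / \<epsilon> ^ n" for w
        using \<psi>(2,3)[of x w] d[of w] \<epsilon> B by (auto intro!: frac_le power_mono simp: less_imp_le)
      have "integrable N (\<lambda>w. \<psi> x w ^ m / d w ^ n)"
        using bnd by (intro N.integrable_const_bound[of _ "B ^ m / \<epsilon> ^ n"]) auto
      hence "(\<integral>\<^sup>+w. ennreal (\<psi> x w ^ m / d w ^ n) \<partial>N) = ennreal (LINT w|N. \<psi> x w ^ m / d w ^ n)"
        using \<psi>(2) d(2) by (intro nn_integral_eq_integral) (auto simp: less_imp_le)
      moreover have "(LINT w|N. \<psi> x w) ^ m \<le> (K + \<epsilon>) ^ n * (LINT w|N. \<psi> x w ^ m / d w ^ n)"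
        unfolding n Ed[symmetric]
        by (rule N.expectation_power_le_weighted[where B=B and \<epsilon>=\<epsilon>]) (use \<psi> d \<epsilon> int_d in auto)
      ultimately show "ennreal ((LINT w|N. \<psi> x w) ^ m) \<le> ennreal ((K + \<epsilon>) ^ n) * (\<integral>\<^sup>+w. ennreal (\<psi> x w ^ m / d w ^ n) \<partial>N)"
        using K \<epsilon> by (simp add: ennreal_mult'[symmetric] ennreal_leI)
    qed
    also have "\<dots> = ennreal ((K + \<epsilon>) ^ n) * (\<integral>\<^sup>+x. \<integral>\<^sup>+w. ennreal (\<psi> x w ^ m / d w ^ n) \<partial>N \<partial>M)"
      by (rule nn_integral_cmult) measurable
    also have "(\<integral>\<^sup>+x. \<integral>\<^sup>+w. ennreal (\<psi> x w ^ m / d w ^ n) \<partial>N \<partial>M) = (\<integral>\<^sup>+w. \<integral>\<^sup>+x. ennreal (\<psi> x w ^ m / d w ^ n) \<partial>M \<partial>N)"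
      by (rule Fubini'[symmetric]) measurable
    \<comment> \<open>With \<open>m = n + 1\<close> the inner integral is at most
      \<open>c w ^ m / d w ^ n <= d w\<close>, which supplies the last factor of
      \<open>(K + \<epsilon>) ^ m\<close>.\<close>
    also have "\<dots> \<le> (\<integral>\<^sup>+w. ennreal (d w) \<partial>N)"
    proof (rule nn_integral_mono)
      fix w assume w: "w \<in> space N"
      have [measurable]: "(\<lambda>x. \<psi> x w) \<in> borel_measurable M"
        using measurable_Pair1[OF \<psi>(1) w] by simp
      have "(\<integral>\<^sup>+x. ennreal (\<psi> x w ^ m / d w ^ n) \<partial>M) = (\<integral>\<^sup>+x. ennreal (1 / d w ^ n) * ennreal (\<psi> x w ^ m) \<partial>M)"
        using d(2)[of w] \<psi>(2) by (simp add: ennreal_mult'[symmetric] less_imp_le)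
      also have "\<dots> = ennreal (1 / d w ^ n) * (\<integral>\<^sup>+x. ennreal (\<psi> x w ^ m) \<partial>M)"
        by (rule nn_integral_cmult) measurable
      also have "\<dots> \<le> ennreal (1 / d w ^ n) * ennreal (c w ^ m)"
        by (intro mult_left_mono le w) simp
      also have "\<dots> = ennreal (c w ^ m / d w ^ n)"
        using d(2)[of w] by (simp add: ennreal_mult'[symmetric] less_imp_le)
      also have "\<dots> \<le> ennreal (d w)"
      proof (rule ennreal_leI)
        have "c w ^ m \<le> d w ^ m" using c(2)[of w] \<epsilon> by (intro power_mono) (auto simp: d_def)
        thus "c w ^ m / d w ^ n \<le> d w" using d(2)[of w] by (simp add: divide_le_eq n)
      qed
      finally show "(\<integral>\<^sup>+x. ennreal (\<psi> x w ^ m / d w ^ n) \<partial>M) \<le> ennreal (d w)" .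
    qed
    also have "(\<integral>\<^sup>+w. ennreal (d w) \<partial>N) = ennreal (K + \<epsilon>)"
      unfolding Ed[symmetric] using d(2) by (intro nn_integral_eq_integral int_d) (auto simp: less_imp_le)
    also have "ennreal ((K + \<epsilon>) ^ n) * ennreal (K + \<epsilon>) = ennreal ((K + \<epsilon>) ^ m)"
      using K \<epsilon> by (subst ennreal_mult'[symmetric]) (auto simp: n mult.commute)
    finally show ?thesis by (simp add: mult_left_mono)
  qed
  have "((\<lambda>\<epsilon>. ennreal ((K + \<epsilon>) ^ m)) \<longlongrightarrow> ennreal ((K + 0) ^ m)) (at_right 0)"
    by (intro tendsto_ennrealI tendsto_intros)
  moreover have "\<forall>\<^sub>F \<epsilon> in at_right 0. X \<le> ennreal ((K + \<epsilon>) ^ m)"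
    by (rule eventually_mono[OF eventually_at_right_less]) (rule eps)
  ultimately have "X \<le> ennreal ((K + 0) ^ m)"
    by (intro tendsto_lowerbound) auto
  thus ?thesis unfolding X_def K_def by simp
qed

section \<open>Induction over the coordinates\<close>

text \<open>In the new coordinate the one-variable estimate gives, for each \<open>x\<close>, the
  constant \<open>D\<close> times the m-th power of the mean of \<open>\<psi> x\<close> over the
  circle. Minkowski takes this mean out of the integral over the old coordinates, where the
  induction hypothesis applies to \<open>g\<close> frozen at \<open>cis t\<close>. The assumptions
  range over every \<open>x\<close>, inside the polydisc or not, so freezing a coordinate preserves
  them.\<close>

lemma nn_integral_PiM_sub_poisson_power_le:
  fixes g :: "('i \<Rightarrow> complex) \<Rightarrow> real"
  assumes m: "m \<ge> 2" and I: "finite I"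
    and g: "g \<in> borel_measurable (PiM I (\<lambda>_. borel))" "\<And>x. 0 \<le> g x" "\<And>x. g x \<le> B"
    and cont: "\<And>i x. i \<in> I \<Longrightarrow> continuous_on (sphere 0 1) (\<lambda>y. g (x(i := y)))"
    and sub: "\<And>i x z. i \<in> I \<Longrightarrow> cmod z < 1 \<Longrightarrow>
      g (x(i := z)) \<le> (LINT t|angle_measure. poisson_kernel z (cis t) * g (x(i := cis t)))"
  shows "(\<integral>\<^sup>+x. ennreal (g x ^ (2 * m)) \<partial>PiM I (\<lambda>_. disc_measure m))
     \<le> ennreal ((D_const m ^ (2 * m)) ^ card I *
         (LINT t|PiM I (\<lambda>_. angle_measure). (g (\<lambda>k\<in>I. cis (t k)))\<^sup>2) ^ m)"
  using I g cont sub
proof (induction I arbitrary: g rule: finite_induct)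
  case empty
  interpret P: prob_space "PiM {} (\<lambda>_::'i. angle_measure)" by (intro prob_space_PiM) auto
  have "(LINT t|PiM {} (\<lambda>_::'i. angle_measure). (g (\<lambda>_. undefined))\<^sup>2) = (g (\<lambda>_. undefined))\<^sup>2"
    by (simp add: P.prob_space)
  moreover have "(\<integral>\<^sup>+x. ennreal (g x ^ (2 * m)) \<partial>PiM {} (\<lambda>_. disc_measure m)) = ennreal (g (\<lambda>_. undefined) ^ (2 * m))"
    by (simp add: PiM_empty nn_integral_count_space_finite)
  ultimately show ?case by (simp add: power_mult restrict_def P.prob_space)
next
  case (insert i I)
  interpret D: prob_space "disc_measure m" by (rule prob_space_disc_measure[OF m])
  interpret PD: product_prob_space "\<lambda>_::'i. disc_measure m" by standard
  interpret PA: product_prob_space "\<lambda>_::'i. angle_measure" by standard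
  interpret ID: prob_space "PiM I (\<lambda>_. disc_measure m)" by (intro prob_space_PiM) unfold_locales
  interpret IA: prob_space "PiM I (\<lambda>_. angle_measure)" by (intro prob_space_PiM) unfold_locales
  interpret IIA: prob_space "PiM (insert i I) (\<lambda>_. angle_measure)" by (intro prob_space_PiM) unfold_locales
  interpret pA: pair_sigma_finite "PiM I (\<lambda>_. angle_measure)" angle_measure ..
  note [measurable] = insert.prems(1)
  have sD: "sets (PiM J (\<lambda>_. disc_measure m)) = sets (PiM J (\<lambda>_. borel))" for J :: "'i set"
    by (intro sets_PiM_cong) auto
  have [measurable]: "g \<in> borel_measurable (PiM (insert i I) (\<lambda>_. disc_measure m))"
    using insert.prems(1) by (simp cong: measurable_cong_sets add: sD)
  have upd: "(\<lambda>x. x(i := w)) \<in> PiM I (\<lambda>_. borel) \<rightarrow>\<^sub>M PiM (insert i I) (\<lambda>_. borel)" for w :: complex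
    by (rule measurable_fun_upd[where J=I]) auto
  define D where "D = D_const m ^ (2 * m)"
  \<comment> \<open>The induction hypothesis bounds an m-th power, while Minkowski asks for its m-th
    root \<open>c t\<close>; hence \<open>E\<close> with \<open>E ^ m = D ^ card I\<close>.\<close>
  define E where "E = ((D_const m)\<^sup>2) ^ card I"
  have D0: "D \<ge> 0" unfolding D_def by (simp add: power_mult)
  have ED: "E ^ m = D ^ card I" unfolding E_def D_def by (simp add: power_mult[symmetric] mult_ac)
  define h where "h s t = (g ((\<lambda>k\<in>I. cis (s k))(i := cis t)))\<^sup>2" for s t
  define c where "c t = E * (LINT s|PiM I (\<lambda>_. angle_measure). h s t)" for t
  define \<psi> where "\<psi> x t = (g (x(i := cis t)))\<^sup>2" for x t
  have meas_\<psi> [measurable]: "case_prod \<psi> \<in> borel_measurable (PiM I (\<lambda>_. disc_measure m) \<Otimes>\<^sub>M angle_measure)"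
  proof -
    have "fst \<in> PiM I (\<lambda>_. disc_measure m) \<Otimes>\<^sub>M angle_measure \<rightarrow>\<^sub>M PiM I (\<lambda>_. borel)"
      using measurable_fst measurable_cong_sets[OF refl sD] by blast
    hence "(\<lambda>p. (fst p)(i := cis (snd p))) \<in> PiM I (\<lambda>_. disc_measure m) \<Otimes>\<^sub>M angle_measure \<rightarrow>\<^sub>M PiM (insert i I) (\<lambda>_. borel)"
      by (intro measurable_fun_upd[where J=I]) auto
    from measurable_compose[OF this insert.prems(1)] show ?thesis
      unfolding \<psi>_def case_prod_beta by measurable
  qed
  have meas_h: "case_prod h \<in> borel_measurable (PiM I (\<lambda>_. angle_measure) \<Otimes>\<^sub>M angle_measure)"
  proof -
    have "(\<lambda>p. (\<lambda>k\<in>I. cis (fst p k))(i := cis (snd p))) \<in> PiM I (\<lambda>_. angle_measure) \<Otimes>\<^sub>M angle_measure \<rightarrow>\<^sub>M PiM (insert i I) (\<lambda>_. borel)"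
      by (rule measurable_fun_upd[where J=I]) auto
    from measurable_compose[OF this insert.prems(1)] show ?thesis
      unfolding h_def case_prod_beta by measurable
  qed
  have h0: "0 \<le> h s t" for s t by (simp add: h_def)
  have hB: "h s t \<le> B\<^sup>2" for s t unfolding h_def using insert.prems(2,3) by (intro power_mono)
  have int_h: "integrable (PiM I (\<lambda>_. angle_measure) \<Otimes>\<^sub>M angle_measure) (case_prod h)"
  proof -
    interpret pp: prob_space "PiM I (\<lambda>_. angle_measure) \<Otimes>\<^sub>M angle_measure"
      by (rule prob_space_pair) unfold_locales
    show ?thesis using meas_h h0 hB by (intro pp.integrable_const_bound[of _ "B\<^sup>2"]) auto
  qed
  have "(\<integral>\<^sup>+x. ennreal (g x ^ (2 * m)) \<partial>PiM (insert i I) (\<lambda>_. disc_measure m))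
     = (\<integral>\<^sup>+x. \<integral>\<^sup>+y. ennreal (g (x(i := y)) ^ (2 * m)) \<partial>disc_measure m \<partial>PiM I (\<lambda>_. disc_measure m))"
    using insert.hyps by (intro PD.product_nn_integral_insert) auto
  also have "\<dots> \<le> (\<integral>\<^sup>+x. ennreal D * ennreal ((LINT t|angle_measure. (g (x(i := cis t)))\<^sup>2) ^ m) \<partial>PiM I (\<lambda>_. disc_measure m))"
  proof (rule nn_integral_mono)
    fix x :: "'i \<Rightarrow> complex"
    have "(\<integral>\<^sup>+y. ennreal (g (x(i := y)) ^ (2 * m)) \<partial>disc_measure m)
       \<le> ennreal (D * (LINT t|angle_measure. (g (x(i := cis t)))\<^sup>2) ^ m)"
      unfolding D_def
      by (intro nn_integral_sub_poisson_power_le m insert.prems(2) insert.prems(4) insert.prems(5)) auto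
    thus "(\<integral>\<^sup>+y. ennreal (g (x(i := y)) ^ (2 * m)) \<partial>disc_measure m)
       \<le> ennreal D * ennreal ((LINT t|angle_measure. (g (x(i := cis t)))\<^sup>2) ^ m)"
      using D0 by (simp add: ennreal_mult')
  qed
  also have "\<dots> = ennreal D * (\<integral>\<^sup>+x. ennreal ((LINT t|angle_measure. \<psi> x t) ^ m) \<partial>PiM I (\<lambda>_. disc_measure m))"
    unfolding \<psi>_def[symmetric] by (rule nn_integral_cmult) measurable
  also have "\<dots> \<le> ennreal D * ennreal ((LINT t|angle_measure. c t) ^ m)"
  proof (intro mult_left_mono minkowski_integral_power)
    show "integrable angle_measure c"
      unfolding c_def using pA.integrable_snd[OF int_h] by simp
    show "0 \<le> c t" for t unfolding c_def E_def using h0 by simp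
    show "0 \<le> \<psi> x t" for x t by (simp add: \<psi>_def)
    show "\<psi> x t \<le> B\<^sup>2" for x t unfolding \<psi>_def using insert.prems(2,3) by (intro power_mono)
    show "(\<integral>\<^sup>+x. ennreal (\<psi> x t ^ m) \<partial>PiM I (\<lambda>_. disc_measure m)) \<le> ennreal (c t ^ m)" for t
    proof -
      have "(\<integral>\<^sup>+x. ennreal (g (x(i := cis t)) ^ (2 * m)) \<partial>PiM I (\<lambda>_. disc_measure m))
        \<le> ennreal ((D_const m ^ (2 * m)) ^ card I *
         (LINT s|PiM I (\<lambda>_. angle_measure). (g ((\<lambda>k\<in>I. cis (s k))(i := cis t)))\<^sup>2) ^ m)"
      proof (rule insert.IH)
        show "(\<lambda>x. g (x(i := cis t))) \<in> borel_measurable (PiM I (\<lambda>_. borel))"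
          using measurable_compose[OF upd insert.prems(1)] .
        fix j and x :: "'i \<Rightarrow> complex" assume j: "j \<in> I"
        hence "j \<noteq> i" using insert.hyps by auto
        hence e: "(x(j := y))(i := w) = (x(i := w))(j := y)" for y w by (rule fun_upd_twist)
        show "continuous_on (sphere 0 1) (\<lambda>y. g ((x(j := y))(i := cis t)))"
          unfolding e by (rule insert.prems(4)) (use j in auto)
        show "cmod z < 1 \<Longrightarrow> g ((x(j := z))(i := cis t)) \<le> (LINT s|angle_measure. poisson_kernel z (cis s) * g ((x(j := cis s))(i := cis t)))" for z
          unfolding e by (rule insert.prems(5)) (use j in auto)
      qed (use insert.prems in auto)
      thus ?thesis by (simp add: \<psi>_def c_def h_def power_mult_distrib ED D_def power_mult)
    qed
  qed (use m in \<open>auto intro: prob_space_angle_measure ID.sigma_finite_measure_axioms\<close>)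
  also have "\<dots> = ennreal (D ^ card (insert i I) *
         (LINT t|PiM (insert i I) (\<lambda>_. angle_measure). (g (\<lambda>k\<in>insert i I. cis (t k)))\<^sup>2) ^ m)"
  proof -
    have "integrable (PiM (insert i I) (\<lambda>_. angle_measure)) (\<lambda>t. (g (\<lambda>k\<in>insert i I. cis (t k)))\<^sup>2)"
      using insert.prems(2,3)
      by (intro IIA.integrable_const_bound[of _ "B\<^sup>2"]) (auto intro!: power_mono)
    hence "(LINT t|PiM (insert i I) (\<lambda>_. angle_measure). (g (\<lambda>k\<in>insert i I. cis (t k)))\<^sup>2)
      = (LINT s|PiM I (\<lambda>_. angle_measure). LINT t|angle_measure. (g (\<lambda>k\<in>insert i I. cis ((s(i := t)) k)))\<^sup>2)"
      using insert.hyps by (intro PA.product_integral_insert) auto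
    also have "\<dots> = (LINT s|PiM I (\<lambda>_. angle_measure). LINT t|angle_measure. h s t)"
    proof -
      have "(\<lambda>k\<in>insert i I. cis ((s(i := t)) k)) = (\<lambda>k\<in>I. cis (s k))(i := cis t)" for s t
        using insert.hyps by (auto simp: fun_eq_iff)
      thus ?thesis by (simp only: h_def)
    qed
    also have "\<dots> = (LINT t|angle_measure. LINT s|PiM I (\<lambda>_. angle_measure). h s t)"
      by (rule pA.Fubini_integral[OF int_h, symmetric])
    finally have "(LINT t|angle_measure. c t) = E * (LINT t|PiM (insert i I) (\<lambda>_. angle_measure). (g (\<lambda>k\<in>insert i I. cis (t k)))\<^sup>2)"
      by (simp add: c_def)
    thus ?thesis using insert.hyps D0
      by (simp add: power_mult_distrib ED ennreal_mult'[symmetric] mult.assoc)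
  qed
  finally show ?case unfolding D_def .
qed

section \<open>Pluriharmonic functions and slices\<close>

text \<open>The condition on \<open>L\<close> is the Cauchy-Riemann equation; it makes
  \<open>L\<close> multiplication by \<open>L 1\<close>.\<close>

lemma has_field_derivative_if_complex_linear:
  assumes f: "(f has_derivative L) (at z)" and L: "L \<i> = \<i> * L 1"
  shows "(f has_field_derivative L 1) (at z)"
proof -
  interpret L: bounded_linear L using f by (rule has_derivative_bounded_linear)
  have eq: "L v = L 1 * v" for v
  proof -
    have "v = Re v *\<^sub>R 1 + Im v *\<^sub>R \<i>" by (simp add: complex_eq_iff)
    hence "L v = L (Re v *\<^sub>R 1 + Im v *\<^sub>R \<i>)" by (rule arg_cong)
    also have "\<dots> = Re v *\<^sub>R L 1 + Im v *\<^sub>R L \<i>" by (simp only: L.add L.scaleR)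
    also have "\<dots> = L 1 * (of_real (Re v) + \<i> * of_real (Im v))"
      unfolding L scaleR_conv_of_real by (simp only: distrib_left mult_ac)
    also have "of_real (Re v) + \<i> * of_real (Im v) = v" by (simp add: complex_eq_iff)
    finally show ?thesis .
  qed
  have "L = (*) (L 1)" by (rule ext) (rule eq)
  with f have "(f has_derivative (*) (L 1)) (at z)" by metis
  thus ?thesis by (simp add: has_field_derivative_def)
qed

text \<open>Here \<open>h\<close> is the derivative of \<open>g\<close> with respect to the conjugate variable. The second
  equation says that \<open>cnj \<circ> h\<close> is holomorphic, and \<open>H\<close> is a primitive of it.\<close>

lemma harmonic_decomposition:
  assumes S: "convex S" "open S"
    and g: "\<And>z. z \<in> S \<Longrightarrow> (g has_derivative g' z) (at z)"
    and h: "\<And>z. z \<in> S \<Longrightarrow> (h has_derivative h' z) (at z)"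
    and eq: "\<And>z. z \<in> S \<Longrightarrow> h z = (g' z 1 + \<i> * g' z \<i>) / 2"
      "\<And>z. z \<in> S \<Longrightarrow> h' z 1 = \<i> * h' z \<i>"
  obtains G H where "G holomorphic_on S" "H holomorphic_on S" "\<And>z. z \<in> S \<Longrightarrow> g z = G z + cnj (H z)"
proof -
  have "((\<lambda>z. cnj (h z)) has_field_derivative cnj (h' z 1)) (at z)" if "z \<in> S" for z
  proof (rule has_field_derivative_if_complex_linear)
    show "((\<lambda>z. cnj (h z)) has_derivative (\<lambda>v. cnj (h' z v))) (at z)"
      by (rule bounded_linear.has_derivative[OF bounded_linear_cnj h[OF that]])
    show "cnj (h' z \<i>) = \<i> * cnj (h' z 1)" using eq(2)[OF that] by simp
  qed
  hence "(\<lambda>z. cnj (h z)) holomorphic_on S"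
    unfolding holomorphic_on_open[OF S(2)] by blast
  then obtain H where "\<And>z. z \<in> S \<Longrightarrow> (H has_field_derivative cnj (h z)) (at z within S)"
    using holomorphic_convex_primitive'[OF S] by blast
  hence H: "(H has_field_derivative cnj (h z)) (at z)" if "z \<in> S" for z
    using that S(2) by (metis at_within_open)
  \<comment> \<open>\<open>g\<close> and \<open>cnj (H z)\<close> have the same derivative
    \<open>h\<close> in the conjugate variable, so their difference satisfies the Cauchy-Riemann
    equation.\<close>
  have "((\<lambda>z. g z - cnj (H z)) has_field_derivative (g' z 1 - cnj (cnj (h z) * 1))) (at z)" if "z \<in> S" for z
  proof (rule has_field_derivative_if_complex_linear)
    have "(H has_derivative (\<lambda>v. cnj (h z) * v)) (at z)"
      using H[OF that] by (simp add: has_field_derivative_def)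
    thus "((\<lambda>z. g z - cnj (H z)) has_derivative (\<lambda>v. g' z v - cnj (cnj (h z) * v))) (at z)"
      by (intro has_derivative_diff g that bounded_linear.has_derivative[OF bounded_linear_cnj])
    have "2 * h z = g' z 1 + \<i> * g' z \<i>" using eq(1)[OF that] by (simp add: mult.commute)
    hence e: "g' z 1 = 2 * h z - \<i> * g' z \<i>" by (metis add_diff_cancel_right')
    show "g' z \<i> - cnj (cnj (h z) * \<i>) = \<i> * (g' z 1 - cnj (cnj (h z) * 1))"
      unfolding e by (simp add: right_diff_distrib)
  qed
  hence "(\<lambda>z. g z - cnj (H z)) holomorphic_on S"
    unfolding holomorphic_on_open[OF S(2)] by blast
  moreover have "H holomorphic_on S"
    using H unfolding holomorphic_on_open[OF S(2)] by blast
  ultimately show thesis by (intro that[of "\<lambda>z. g z - cnj (H z)" H]) auto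
qed

section \<open>Jensen's inequality and the Poisson formula for harmonic functions\<close>

text \<open>Convexity on the open half-line; at \<open>x = 0\<close> the claim becomes
  \<open>(1 - s) * a powr s <= 0\<close>.\<close>

lemma powr_above_tangent:
  fixes x a s :: real
  assumes "x \<ge> 0" "a > 0" "s \<ge> 1"
  shows "a powr s + s * a powr (s - 1) * (x - a) \<le> x powr s"
proof (cases "x = 0")
  case True
  have "a powr (s - 1) * a = a powr s" using assms by (simp add: powr_diff)
  hence e: "s * a powr (s - 1) * (0 - a) = - s * a powr s" by simp
  have "1 * a powr s \<le> s * a powr s" using assms by (intro mult_right_mono) auto
  thus ?thesis unfolding True e by simp
next
  case False
  have "s * a powr (s - 1) * (x - a) \<le> x powr s - a powr s"
  proof (rule convex_on_imp_above_tangent[OF powr_convex[OF assms(3)]])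
    show "((\<lambda>x. x powr s) has_real_derivative s * a powr (s - 1)) (at a within {0<..})"
      using assms by (auto intro!: derivative_eq_intros)
    have "interior {0<..} = {0::real<..}" by (rule interior_open) auto
    thus "a \<in> interior {0<..}" using assms by simp
  qed (use False assms in auto)
  thus ?thesis by simp
qed

text \<open>Jensen for the probability measure whose density is the Poisson kernel. The tangent is
  taken at \<open>a = |gz|\<close> and not at the mean of \<open>|g|\<close>: that mean is at least
  \<open>a\<close> by the triangle inequality and the slope is nonnegative, so the tangent line at
  the mean is still at least \<open>a powr s\<close>. A tangent needs \<open>a > 0\<close>, hence
  the case distinction.\<close>

lemma cmod_powr_le_poisson:
  fixes g :: "complex \<Rightarrow> complex"
  assumes cont: "continuous_on (sphere 0 1) g" and z: "cmod z < 1" and s: "s \<ge> 1"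
    and gz: "gz = (LINT t|angle_measure. of_real (poisson_kernel z (cis t)) * g (cis t))"
  shows "cmod gz powr s \<le> (LINT t|angle_measure. poisson_kernel z (cis t) * cmod (g (cis t)) powr s)"
proof (cases "gz = 0")
  case True
  have "0 \<le> (LINT t|angle_measure. poisson_kernel z (cis t) * cmod (g (cis t)) powr s)"
    using z by (intro Bochner_Integration.integral_nonneg mult_nonneg_nonneg poisson_kernel_nonneg) auto
  thus ?thesis using True by simp
next
  case False
  define a where "a = cmod gz"
  have a: "a > 0" using False by (simp add: a_def)
  let ?P = "\<lambda>t. poisson_kernel z (cis t)"
  have i0: "integrable angle_measure ?P"
    using z by (intro integrable_circle continuous_intros)
  have i1: "integrable angle_measure (\<lambda>t. ?P t * cmod (g (cis t)))"
    using z cont by (intro integrable_circle[of "\<lambda>w. poisson_kernel z w * cmod (g w)"] continuous_intros)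
  have i2: "integrable angle_measure (\<lambda>t. ?P t * cmod (g (cis t)) powr s)"
    using z cont s by (intro integrable_circle[of "\<lambda>w. poisson_kernel z w * cmod (g w) powr s"] continuous_intros continuous_on_powr') auto
  have "a \<le> (LINT t|angle_measure. cmod (of_real (?P t) * g (cis t)))"
    unfolding a_def gz by (rule integral_norm_bound)
  also have "\<dots> = (LINT t|angle_measure. ?P t * cmod (g (cis t)))"
    using z by (intro Bochner_Integration.integral_cong) (auto simp: norm_mult poisson_kernel_nonneg)
  finally have le: "a \<le> (LINT t|angle_measure. ?P t * cmod (g (cis t)))" .
  have "a powr s \<le> a powr s + s * a powr (s - 1) * ((LINT t|angle_measure. ?P t * cmod (g (cis t))) - a)"
    using le s by simp
  also have "\<dots> = (LINT t|angle_measure. ?P t) * (a powr s - s * a powr (s - 1) * a)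
      + s * a powr (s - 1) * (LINT t|angle_measure. ?P t * cmod (g (cis t)))"
    using integral_poisson_kernel[OF z] by (simp add: algebra_simps)
  also have "\<dots> = (LINT t|angle_measure. ?P t * (a powr s - s * a powr (s - 1) * a)
      + s * a powr (s - 1) * (?P t * cmod (g (cis t))))"
    using i0 i1 by simp
  also have "\<dots> \<le> (LINT t|angle_measure. ?P t * cmod (g (cis t)) powr s)"
  proof (rule integral_mono)
    fix t
    have "?P t * (a powr s + s * a powr (s - 1) * (cmod (g (cis t)) - a)) \<le> ?P t * cmod (g (cis t)) powr s"
      using z a s by (intro mult_left_mono powr_above_tangent poisson_kernel_nonneg) auto
    thus "?P t * (a powr s - s * a powr (s - 1) * a) + s * a powr (s - 1) * (?P t * cmod (g (cis t)))
       \<le> ?P t * cmod (g (cis t)) powr s" by (simp add: algebra_simps)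
  qed (use i0 i1 i2 in auto)
  finally show ?thesis unfolding a_def .
qed

text \<open>The dilation by \<open>r\<close> makes both parts continuous up to the circle, and since
  the kernel is real the formula for \<open>H\<close> can be conjugated.\<close>

lemma poisson_formula_harmonic:
  assumes G: "G holomorphic_on ball 0 1" and H: "H holomorphic_on ball 0 1"
    and g: "\<And>z. cmod z < 1 \<Longrightarrow> g z = G z + cnj (H z)"
    and r: "0 < r" "r < 1" and z: "cmod z < 1"
  shows "g (of_real r * z) = (LINT t|angle_measure. of_real (poisson_kernel z (cis t)) * g (of_real r * cis t))"
proof -
  have b: "of_real r * w \<in> ball 0 1" if "cmod w \<le> 1" for w :: complex
  proof -
    have "r * cmod w \<le> r * 1" using that r by (intro mult_left_mono) auto
    hence "r * cmod w < 1" using r by linarith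
    thus ?thesis using r by (simp add: norm_mult)
  qed
  have cont: "continuous_on (cball 0 1) (\<lambda>w. F (of_real r * w))" if "F holomorphic_on ball 0 1" for F
  proof (rule continuous_on_compose2[OF holomorphic_on_imp_continuous_on[OF that]])
    show "continuous_on (cball 0 1) (\<lambda>w. complex_of_real r * w)" by (intro continuous_intros)
  qed (use b in auto)
  have hol: "(\<lambda>w. F (of_real r * w)) holomorphic_on ball 0 1" if "F holomorphic_on ball 0 1" for F
  proof (rule holomorphic_on_compose_gen[OF _ that, unfolded o_def])
    show "(\<lambda>w. complex_of_real r * w) holomorphic_on ball 0 1" by (intro holomorphic_intros)
  qed (use b in auto)
  have P: "(LINT t|angle_measure. of_real (poisson_kernel z (cis t)) * F (of_real r * cis t)) = F (of_real r * z)"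
    if "F holomorphic_on ball 0 1" for F
    using poisson_formula_holomorphic[OF cont[OF that] hol[OF that] z] .
  have i: "integrable angle_measure (\<lambda>t. of_real (poisson_kernel z (cis t)) * F (of_real r * cis t))"
    if "F holomorphic_on ball 0 1" for F
    using z by (intro integrable_circle[of "\<lambda>w. of_real (poisson_kernel z w) * F (of_real r * w)"]
      continuous_intros continuous_on_subset[OF cont[OF that]]) auto
  have "(LINT t|angle_measure. of_real (poisson_kernel z (cis t)) * g (of_real r * cis t))
     = (LINT t|angle_measure. of_real (poisson_kernel z (cis t)) * G (of_real r * cis t)
         + cnj (of_real (poisson_kernel z (cis t)) * H (of_real r * cis t)))"
    using b[of "cis t" for t] by (intro Bochner_Integration.integral_cong) (auto simp: g distrib_left)
  also have "\<dots> = (LINT t|angle_measure. of_real (poisson_kernel z (cis t)) * G (of_real r * cis t))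
     + (LINT t|angle_measure. cnj (of_real (poisson_kernel z (cis t)) * H (of_real r * cis t)))"
    by (intro Bochner_Integration.integral_add i G integrable_cnj H)
  also have "\<dots> = G (of_real r * z) + cnj (H (of_real r * z))"
    by (simp only: Bochner_Integration.integral_cnj P G H)
  also have "\<dots> = g (of_real r * z)" using b[of z] z by (subst g) auto
  finally show ?thesis ..
qed

section \<open>Slices of pluriharmonic functions\<close>

definition slice :: "'n \<Rightarrow> complex ^ 'n \<Rightarrow> complex \<Rightarrow> complex ^ 'n" where
  "slice k z y = (\<chi> j. if j = k then y else z $ j)"

lemma slice_nth [simp]: "slice k z y $ j = (if j = k then y else z $ j)"
  by (simp add: slice_def)

lemma bounded_linear_axis: "bounded_linear (axis k :: complex \<Rightarrow> complex ^ 'n::finite)"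
  unfolding linear_conv_bounded_linear[symmetric]
  by (rule linearI) (auto simp: vec_eq_iff axis_def)

lemma has_derivative_slice: "(slice k z has_derivative axis k) (at y)"
proof -
  have "slice k z = (\<lambda>y. slice k z 0 + axis k y)" by (auto simp: fun_eq_iff vec_eq_iff axis_def)
  moreover have "((\<lambda>y. slice k z 0 + axis k y) has_derivative axis k) (at y)"
    using has_derivative_add[OF has_derivative_const bounded_linear_imp_has_derivative[OF bounded_linear_axis]]
    by simp
  ultimately show ?thesis by metis
qed

lemma slice_in_polydisc: "cmod y < 1 \<Longrightarrow> (\<And>j. j \<noteq> k \<Longrightarrow> cmod (z $ j) < 1) \<Longrightarrow> slice k z y \<in> polydisc"
  by (auto simp: polydisc_def)

text \<open>The equation with \<open>j = k\<close>, read along the slice, is the second equation of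
  \<open>harmonic_decomposition\<close>. The second derivatives in \<open>C2_on\<close> make
  \<open>wirtinger_bar k f\<close> differentiable, so the chain rule applies to it as well.\<close>

lemma pluriharmonic_slice_decomposition:
  fixes f :: "complex ^ 'n::finite \<Rightarrow> complex"
  assumes f: "pluriharmonic_on polydisc f" and z: "\<And>j. j \<noteq> k \<Longrightarrow> cmod (z $ j) < 1"
  obtains G H where "G holomorphic_on ball 0 1" "H holomorphic_on ball 0 1"
    "\<And>y. cmod y < 1 \<Longrightarrow> f (slice k z y) = G y + cnj (H y)"
proof -
  have df: "(f has_derivative frechet_derivative f (at x)) (at x)" if "x \<in> polydisc" for x
    using f that unfolding pluriharmonic_on_def C2_on_def C1_on_def
    by (auto simp: frechet_derivative_works)
  have dd: "(\<lambda>x. frechet_derivative f (at x) v) differentiable (at x)" if "x \<in> polydisc" for x v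
    using f that unfolding pluriharmonic_on_def C2_on_def C1_on_def by auto
  have dw: "(wirtinger_bar k f has_derivative frechet_derivative (wirtinger_bar k f) (at x)) (at x)"
    if "x \<in> polydisc" for x
  proof -
    have "wirtinger_bar k f differentiable (at x)"
      unfolding wirtinger_bar_def[abs_def] divide_inverse
      by (intro differentiable_mult differentiable_add differentiable_const dd that)
    thus ?thesis by (simp add: frechet_derivative_works)
  qed
  have w0: "frechet_derivative (wirtinger_bar k f) (at x) (axis k 1)
      = \<i> * frechet_derivative (wirtinger_bar k f) (at x) (axis k \<i>)" if "x \<in> polydisc" for x
    using f that unfolding pluriharmonic_on_def wirtinger_def by auto
  have S: "slice k z y \<in> polydisc" if "y \<in> ball 0 1" for y
    using that z by (intro slice_in_polydisc) auto
  show thesis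
  proof (rule harmonic_decomposition[of "ball 0 1" "\<lambda>y. f (slice k z y)"
        "\<lambda>y v. frechet_derivative f (at (slice k z y)) (axis k v)"
        "\<lambda>y. wirtinger_bar k f (slice k z y)"
        "\<lambda>y v. frechet_derivative (wirtinger_bar k f) (at (slice k z y)) (axis k v)"])
    fix y :: complex assume y: "y \<in> ball 0 1"
    show "((\<lambda>y. f (slice k z y)) has_derivative (\<lambda>v. frechet_derivative f (at (slice k z y)) (axis k v))) (at y)"
      by (rule has_derivative_compose[OF has_derivative_slice df[OF S[OF y]]])
    show "((\<lambda>y. wirtinger_bar k f (slice k z y)) has_derivative (\<lambda>v. frechet_derivative (wirtinger_bar k f) (at (slice k z y)) (axis k v))) (at y)"
      by (rule has_derivative_compose[OF has_derivative_slice dw[OF S[OF y]]])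
    show "frechet_derivative (wirtinger_bar k f) (at (slice k z y)) (axis k 1)
      = \<i> * frechet_derivative (wirtinger_bar k f) (at (slice k z y)) (axis k \<i>)"
      by (rule w0[OF S[OF y]])
  qed (auto simp: wirtinger_bar_def intro: that)
qed

lemma pluriharmonic_imp_continuous_on:
  fixes f :: "complex ^ 'n::finite \<Rightarrow> complex"
  assumes "pluriharmonic_on polydisc f"
  shows "continuous_on polydisc f"
proof (rule continuous_at_imp_continuous_on, rule ballI)
  fix x :: "complex ^ 'n" assume "x \<in> polydisc"
  hence "f differentiable (at x)"
    using assms unfolding pluriharmonic_on_def C2_on_def C1_on_def by auto
  thus "isCont f x" by (rule differentiable_imp_continuous_within)
qed

section \<open>Geometry of the polydisc and its closure\<close>

definition closed_polydisc :: "(complex ^ 'n) set" where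
  "closed_polydisc = {z. \<forall>k. cmod (z $ k) \<le> 1}"

lemma closed_closed_polydisc: "closed (closed_polydisc :: (complex ^ 'n::finite) set)"
proof -
  have "closed_polydisc = (\<Inter>k. {z :: complex ^ 'n. cmod (z $ k) \<le> 1})" by (auto simp: closed_polydisc_def)
  moreover have "closed \<dots>" by (intro closed_INT ballI closed_Collect_le continuous_intros)
  ultimately show ?thesis by (simp only:)
qed

lemma compact_closed_polydisc: "compact (closed_polydisc :: (complex ^ 'n::finite) set)"
proof -
  have "norm z \<le> real CARD('n)" if "z \<in> closed_polydisc" for z :: "complex ^ 'n"
  proof -
    have "norm z \<le> (\<Sum>k\<in>UNIV. cmod (z $ k))" unfolding norm_vec_def by (rule L2_set_le_sum) simp
    also have "\<dots> \<le> (\<Sum>k\<in>(UNIV::'n set). 1)" using that by (intro sum_mono) (auto simp: closed_polydisc_def)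
    finally show ?thesis by simp
  qed
  hence "bounded (closed_polydisc :: (complex ^ 'n) set)" unfolding bounded_iff by blast
  thus ?thesis using closed_closed_polydisc by (simp add: compact_eq_bounded_closed)
qed

lemma open_polydisc: "open (polydisc :: (complex ^ 'n::finite) set)"
proof -
  have "polydisc = (\<Inter>k. {z :: complex ^ 'n. cmod (z $ k) < 1})" by (auto simp: polydisc_def)
  moreover have "open \<dots>" by (intro open_INT ballI open_Collect_less continuous_intros) auto
  ultimately show ?thesis by (simp only:)
qed

lemma scaleR_closed_polydisc:
  "0 \<le> r \<Longrightarrow> r < 1 \<Longrightarrow> z \<in> closed_polydisc \<Longrightarrow> r *\<^sub>R z \<in> polydisc"
proof -
  assume r: "0 \<le> r" "r < 1" and z: "z \<in> closed_polydisc"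
  have "r * cmod (z $ k) < 1" for k
  proof -
    have "r * cmod (z $ k) \<le> r * 1" using r z by (intro mult_left_mono) (auto simp: closed_polydisc_def)
    thus ?thesis using r by linarith
  qed
  thus ?thesis using r by (auto simp: polydisc_def)
qed

text \<open>Product measures live on functions and the norms on vectors; this map carries one to the
  other.\<close>

definition vec_of :: "('n \<Rightarrow> 'a) \<Rightarrow> 'a ^ 'n" where "vec_of x = (\<chi> k. x k)"

lemma vec_of_nth [simp]: "vec_of x $ k = x k" by (simp add: vec_of_def)

lemma vec_of_upd: "vec_of (x(k := y)) = slice k (vec_of x) y"
  by (simp add: vec_eq_iff)

lemma measurable_vec_of [measurable]:
  "(vec_of :: ('n::finite \<Rightarrow> complex) \<Rightarrow> _) \<in> borel_measurable (PiM UNIV (\<lambda>_. borel))"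
proof (subst borel_measurable_euclidean_space, rule ballI)
  fix b :: "complex ^ 'n" assume "b \<in> Basis"
  then obtain k c where b: "b = axis k c" unfolding Basis_vec_def by auto
  have "vec_of x \<bullet> b = x k \<bullet> c" for x unfolding b by (simp add: inner_axis)
  thus "(\<lambda>x. vec_of x \<bullet> b) \<in> borel_measurable (PiM UNIV (\<lambda>_. borel))" by simp
qed

text \<open>The indicator makes every slice through a point outside the closed polydisc vanish, so that
  all slices are sub-Poisson.\<close>

definition dilated_power :: "(complex ^ 'n \<Rightarrow> complex) \<Rightarrow> real \<Rightarrow> real \<Rightarrow> complex ^ 'n \<Rightarrow> real" where
  "dilated_power f r s z = indicator closed_polydisc z * cmod (f (r *\<^sub>R z)) powr s"

section \<open>Dilated powers on slices\<close>

lemma continuous_on_dilated: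
  fixes f :: "complex ^ 'n::finite \<Rightarrow> complex"
  assumes "pluriharmonic_on polydisc f" "0 \<le> r" "r < 1"
  shows "continuous_on closed_polydisc (\<lambda>z. f (r *\<^sub>R z))"
  by (rule continuous_on_compose2[OF pluriharmonic_imp_continuous_on[OF assms(1)]])
     (use assms in \<open>auto intro!: continuous_intros scaleR_closed_polydisc\<close>)

lemma continuous_on_slice: "continuous_on S (slice k (z :: complex ^ 'n::finite))"
proof (rule continuous_at_imp_continuous_on, rule ballI)
  fix y show "isCont (slice k z) y" by (rule has_derivative_continuous[OF has_derivative_slice])
qed

lemma slice_in_closed_polydisc_iff:
  "slice k z y \<in> closed_polydisc \<longleftrightarrow> cmod y \<le> 1 \<and> (\<forall>j. j \<noteq> k \<longrightarrow> cmod (z $ j) \<le> 1)"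
  by (auto simp: closed_polydisc_def)

lemma scaleR_slice: "r *\<^sub>R slice k z y = slice k (r *\<^sub>R z) (complex_of_real r * y)"
  by (auto simp: vec_eq_iff scaleR_conv_of_real[where 'a=complex])

text \<open>If the other coordinates lie in the closed disc, the dilation moves the whole closed
  slice into the open polydisc, where the Poisson formula and Jensen apply. Otherwise both sides are
  0.\<close>

lemma dilated_power_sub_poisson:
  fixes f :: "complex ^ 'n::finite \<Rightarrow> complex"
  assumes f: "pluriharmonic_on polydisc f" and r: "0 < r" "r < 1" and s: "s \<ge> 1"
  shows "continuous_on (sphere 0 1) (\<lambda>y. dilated_power f r s (slice k z y))" (is ?cont)
    and "cmod y < 1 \<Longrightarrow> dilated_power f r s (slice k z y)
       \<le> (LINT t|angle_measure. poisson_kernel y (cis t) * dilated_power f r s (slice k z (cis t)))"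
proof -
  have "?cont \<and> (cmod y < 1 \<longrightarrow> dilated_power f r s (slice k z y)
       \<le> (LINT t|angle_measure. poisson_kernel y (cis t) * dilated_power f r s (slice k z (cis t))))"
  proof (cases "\<forall>j. j \<noteq> k \<longrightarrow> cmod (z $ j) \<le> 1")
    case False
    hence "dilated_power f r s (slice k z y) = 0" for y
      by (auto simp: dilated_power_def slice_in_closed_polydisc_iff)
    thus ?thesis by simp
  next
    case True
    have eq: "dilated_power f r s (slice k z y) = cmod (f (r *\<^sub>R slice k z y)) powr s" if "cmod y \<le> 1" for y
      using that True by (simp add: dilated_power_def slice_in_closed_polydisc_iff)
    have cont: "continuous_on (sphere 0 1) (\<lambda>y. f (r *\<^sub>R slice k z y))"
      by (rule continuous_on_compose2[OF continuous_on_dilated[OF f, of r] continuous_on_slice])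
         (use r True in \<open>auto simp: slice_in_closed_polydisc_iff\<close>)
    have 1: ?cont
    proof (subst continuous_on_cong[OF refl eq])
      show "continuous_on (sphere 0 1) (\<lambda>y. cmod (f (r *\<^sub>R slice k z y)) powr s)"
        using s by (intro continuous_on_powr' continuous_intros cont) auto
    qed auto
    have "cmod (f (r *\<^sub>R slice k z y)) powr s \<le>
        (LINT t|angle_measure. poisson_kernel y (cis t) * cmod (f (r *\<^sub>R slice k z (cis t))) powr s)"
      if y: "cmod y < 1"
    proof (rule cmod_powr_le_poisson[OF cont y s])
      have rz: "cmod ((r *\<^sub>R z) $ j) < 1" if "j \<noteq> k" for j
      proof -
        have "r * cmod (z $ j) \<le> r * 1" using r True that by (intro mult_left_mono) auto
        hence "r * cmod (z $ j) < 1" using r by linarith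
        thus ?thesis using r by simp
      qed
      obtain G H where GH: "G holomorphic_on ball 0 1" "H holomorphic_on ball 0 1"
        "\<And>y. cmod y < 1 \<Longrightarrow> f (slice k (r *\<^sub>R z) y) = G y + cnj (H y)"
        by (rule pluriharmonic_slice_decomposition[OF f, of k "r *\<^sub>R z"]) (use rz in auto)
      show "f (r *\<^sub>R slice k z y) = (LINT t|angle_measure. of_real (poisson_kernel y (cis t)) * f (r *\<^sub>R slice k z (cis t)))"
        unfolding scaleR_slice by (rule poisson_formula_harmonic[OF GH r y])
    qed
    thus ?thesis using 1 by (auto simp: eq)
  qed
  thus ?cont "cmod y < 1 \<Longrightarrow> dilated_power f r s (slice k z y)
       \<le> (LINT t|angle_measure. poisson_kernel y (cis t) * dilated_power f r s (slice k z (cis t)))" by auto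
qed

lemma dilated_power_measurable [measurable]:
  fixes f :: "complex ^ 'n::finite \<Rightarrow> complex"
  assumes f: "pluriharmonic_on polydisc f" and r: "0 \<le> r" "r < 1" and s: "s > 0"
  shows "dilated_power f r s \<in> borel_measurable borel"
proof -
  have "continuous_on closed_polydisc (\<lambda>z. cmod (f (r *\<^sub>R z)) powr s)"
    using s by (intro continuous_on_powr' continuous_intros continuous_on_dilated f r) auto
  from borel_measurable_continuous_on_indicator[OF borel_closed[OF closed_closed_polydisc] this] show ?thesis
    unfolding dilated_power_def[abs_def] by simp
qed

lemma dilated_power_bounded:
  fixes f :: "complex ^ 'n::finite \<Rightarrow> complex"
  assumes f: "pluriharmonic_on polydisc f" and r: "0 \<le> r" "r < 1" and s: "s > 0"
  obtains B where "\<And>z. dilated_power f r s z \<le> B"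
proof -
  have "continuous_on closed_polydisc (\<lambda>z. cmod (f (r *\<^sub>R z)) powr s)"
    using s by (intro continuous_on_powr' continuous_intros continuous_on_dilated f r) auto
  hence "compact ((\<lambda>z. cmod (f (r *\<^sub>R z)) powr s) ` closed_polydisc)"
    by (intro compact_continuous_image compact_closed_polydisc)
  then obtain B where B: "\<forall>x\<in>(\<lambda>z. cmod (f (r *\<^sub>R z)) powr s) ` closed_polydisc. norm x \<le> B"
    using compact_imp_bounded bounded_iff by metis
  show thesis
  proof (rule that[of "max B 0"])
    fix z show "dilated_power f r s z \<le> max B 0"
      using B unfolding dilated_power_def by (cases "z \<in> closed_polydisc") auto
  qed
qed

section \<open>Product measures\<close>

lemma prod_Basis_vec:
  fixes f :: "'a::euclidean_space ^ 'n::finite \<Rightarrow> 'b::comm_monoid_mult"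
  shows "(\<Prod>b\<in>Basis. f b) = (\<Prod>k\<in>UNIV. \<Prod>c\<in>Basis. f (axis k c))"
proof -
  have e: "(Basis :: ('a ^ 'n) set) = (\<lambda>(k, c). axis k c) ` (UNIV \<times> Basis)"
    by (auto simp: Basis_vec_def)
  have inj: "inj_on (\<lambda>(k, c). axis k c) ((UNIV :: 'n set) \<times> (Basis :: 'a set))"
    by (auto simp: inj_on_def axis_eq_axis nonzero_Basis)
  have "(\<Prod>b\<in>Basis. f b) = (\<Prod>(k, c)\<in>UNIV \<times> Basis. f (axis k c))"
    unfolding e prod.reindex[OF inj] by (simp add: case_prod_beta o_def)
  thus ?thesis by (simp add: prod.cartesian_product)
qed

lemma lborel_vec_eq_distr_PiM:
  "(lborel :: (complex ^ 'n::finite) measure) = distr (PiM UNIV (\<lambda>_. lborel)) borel vec_of"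
proof (rule lborel_eqI)
  interpret P: product_sigma_finite "\<lambda>_::'n. lborel :: complex measure" by standard
  have s: "sets (PiM (UNIV :: 'n set) (\<lambda>_. lborel :: complex measure)) = sets (PiM UNIV (\<lambda>_. borel))"
    by (intro sets_PiM_cong) auto
  have [measurable]: "vec_of \<in> PiM (UNIV :: 'n set) (\<lambda>_. lborel :: complex measure) \<rightarrow>\<^sub>M borel"
    using measurable_vec_of measurable_cong_sets[OF s refl] by blast
  fix l u :: "complex ^ 'n" assume lu: "\<And>b. b \<in> Basis \<Longrightarrow> l \<bullet> b \<le> u \<bullet> b"
  have le: "(l $ k) \<bullet> c \<le> (u $ k) \<bullet> c" if "c \<in> Basis" for k c
    using lu[of "axis k c"] that by (simp add: inner_axis axis_in_Basis_iff)
  have "vec_of -` box l u = Pi\<^sub>E UNIV (\<lambda>k. box (l $ k) (u $ k))"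
    by (auto simp: box_def Basis_vec_def inner_axis PiE_def)
  hence "emeasure (distr (PiM UNIV (\<lambda>_. lborel)) borel vec_of) (box l u)
     = emeasure (PiM UNIV (\<lambda>_. lborel)) (Pi\<^sub>E UNIV (\<lambda>k. box (l $ k) (u $ k)))"
    by (subst emeasure_distr) (auto simp: space_PiM)
  also have "\<dots> = (\<Prod>k\<in>UNIV. emeasure lborel (box (l $ k) (u $ k)))"
    by (rule P.emeasure_PiM) auto
  also have "\<dots> = (\<Prod>k\<in>UNIV. ennreal (\<Prod>c\<in>Basis. (u $ k - l $ k) \<bullet> c))"
    using le by (intro prod.cong emeasure_lborel_box) auto
  also have "\<dots> = ennreal (\<Prod>k\<in>UNIV. \<Prod>c\<in>Basis. (u $ k - l $ k) \<bullet> c)"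
    using le by (intro prod_ennreal prod_nonneg) (auto simp: inner_diff_left)
  also have "\<dots> = ennreal (\<Prod>b\<in>Basis. (u - l) \<bullet> b)"
    by (simp add: prod_Basis_vec inner_axis)
  finally show "emeasure (distr (PiM UNIV (\<lambda>_. lborel)) borel vec_of) (box l u) = ennreal (\<Prod>b\<in>Basis. (u - l) \<bullet> b)" .
qed simp

text \<open>On a box the integrand factors over the coordinates, and boxes determine the product
  measure.\<close>

lemma density_PiM:
  assumes I: "finite I" and M: "product_sigma_finite M"
    and N: "product_sigma_finite (\<lambda>i. density (M i) (f i))"
    and f: "\<And>i. f i \<in> borel_measurable (M i)"
  shows "density (PiM I M) (\<lambda>x. \<Prod>i\<in>I. f i (x i)) = PiM I (\<lambda>i. density (M i) (f i))"
proof -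
  interpret M: product_sigma_finite M by fact
  interpret N: product_sigma_finite "\<lambda>i. density (M i) (f i)" by fact
  note [measurable] = f
  show ?thesis
  proof (rule N.PiM_eqI[OF I])
    show "sets (density (PiM I M) (\<lambda>x. \<Prod>i\<in>I. f i (x i))) = sets (PiM I (\<lambda>i. density (M i) (f i)))"
      by (simp cong: sets_PiM_cong)
    fix A assume "\<And>i. i \<in> I \<Longrightarrow> A i \<in> sets (density (M i) (f i))"
    hence A [measurable]: "\<And>i. i \<in> I \<Longrightarrow> A i \<in> sets (M i)" by simp
    have "emeasure (density (PiM I M) (\<lambda>x. \<Prod>i\<in>I. f i (x i))) (Pi\<^sub>E I A)
       = (\<integral>\<^sup>+x. (\<Prod>i\<in>I. f i (x i)) * indicator (Pi\<^sub>E I A) x \<partial>PiM I M)"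
      using I A by (intro emeasure_density sets_PiM_I_finite) measurable
    also have "\<dots> = (\<integral>\<^sup>+x. (\<Prod>i\<in>I. f i (x i) * indicator (A i) (x i)) \<partial>PiM I M)"
    proof (rule nn_integral_cong)
      fix x assume x: "x \<in> space (PiM I M)"
      have "indicator (Pi\<^sub>E I A) x = (\<Prod>i\<in>I. indicator (A i) (x i) :: ennreal)"
      proof (cases "\<forall>i\<in>I. x i \<in> A i")
        case True
        hence "x \<in> Pi\<^sub>E I A" using x by (auto simp: space_PiM PiE_def)
        thus ?thesis using True by simp
      next
        case False
        then obtain i where i: "i \<in> I" "x i \<notin> A i" by blast
        hence "x \<notin> Pi\<^sub>E I A" by auto
        moreover have "(\<Prod>i\<in>I. indicator (A i) (x i) :: ennreal) = 0"
          using i I by (intro prod_zero) (auto intro!: bexI[of _ i])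
        ultimately show ?thesis by simp
      qed
      thus "(\<Prod>i\<in>I. f i (x i)) * indicator (Pi\<^sub>E I A) x = (\<Prod>i\<in>I. f i (x i) * indicator (A i) (x i))"
        by (simp add: prod.distrib)
    qed
    also have "\<dots> = (\<Prod>i\<in>I. \<integral>\<^sup>+y. f i y * indicator (A i) y \<partial>M i)"
      using I A by (intro M.product_nn_integral_prod) auto
    also have "\<dots> = (\<Prod>i\<in>I. emeasure (density (M i) (f i)) (A i))"
      using A by (intro prod.cong emeasure_density[symmetric]) auto
    finally show "emeasure (density (PiM I M) (\<lambda>x. \<Prod>i\<in>I. f i (x i))) (Pi\<^sub>E I A)
       = (\<Prod>i\<in>I. emeasure (density (M i) (f i)) (A i))" .
  qed
qed

section \<open>The Bergman and Haar measures as products\<close>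

lemma nn_integral_bergman_measure:
  fixes F :: "complex ^ 'n::finite \<Rightarrow> ennreal"
  assumes m: "m \<ge> 2" and F [measurable]: "F \<in> borel_measurable borel"
  shows "(\<integral>\<^sup>+z. F z \<partial>bergman_measure m) = (\<integral>\<^sup>+x. F (vec_of x) \<partial>PiM UNIV (\<lambda>_. disc_measure m))"
proof -
  define e where "e y = ennreal ((real m - 1) / pi * (1 - (cmod y)\<^sup>2) ^ (m - 2)) * indicator (ball 0 1) y" for y :: complex
  define d where "d z = ennreal ((real m - 1) ^ CARD('n) / pi ^ CARD('n) * (\<Prod>k\<in>UNIV. (1 - (cmod (z $ k))\<^sup>2) ^ (m - 2)))"
    for z :: "complex ^ 'n"
  interpret D: prob_space "disc_measure m" by (rule prob_space_disc_measure[OF m])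
  have [measurable]: "ball (0::complex) 1 \<in> sets borel" by simp
  have [measurable]: "e \<in> borel_measurable borel" unfolding e_def by measurable
  have disc: "disc_measure m = density lborel e" unfolding disc_measure_def e_def[abs_def] ..
  have P [measurable]: "(polydisc :: (complex ^ 'n) set) \<in> sets borel" using open_polydisc by (rule borel_open)
  have [measurable]: "(\<lambda>z :: complex ^ 'n. (real m - 1) ^ CARD('n) / pi ^ CARD('n) * (\<Prod>k\<in>UNIV. (1 - (cmod (z $ k))\<^sup>2) ^ (m - 2))) \<in> borel_measurable borel"
    by (intro borel_measurable_continuous_onI continuous_intros) auto
  have [measurable]: "d \<in> borel_measurable borel" unfolding d_def by measurable
  have s: "sets (PiM (UNIV :: 'n set) (\<lambda>_. lborel :: complex measure)) = sets (PiM UNIV (\<lambda>_. borel))"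
    by (intro sets_PiM_cong) auto
  have [measurable]: "vec_of \<in> PiM (UNIV :: 'n set) (\<lambda>_. lborel :: complex measure) \<rightarrow>\<^sub>M borel"
    using measurable_vec_of measurable_cong_sets[OF s refl] by blast
  \<comment> \<open>Each coordinate receives one factor \<open>(m - 1) / pi\<close> of the
    normalising constant. The indicator of the polydisc is the product of the indicators of the
    discs, so off the polydisc some factor \<open>e (x k)\<close> vanishes.\<close>
  have de: "d (vec_of x) * indicator polydisc (vec_of x) = (\<Prod>k\<in>UNIV. e (x k))" for x
  proof (cases "vec_of x \<in> polydisc")
    case True
    hence x: "cmod (x k) < 1" for k by (simp add: polydisc_def)
    have nn: "0 \<le> (real m - 1) / pi * (1 - (cmod (x k))\<^sup>2) ^ (m - 2)" for k
      using m abs_square_le_1[of "cmod (x k)"] less_imp_le[OF x[of k]] by (intro mult_nonneg_nonneg zero_le_power) auto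
    have "(\<Prod>k\<in>UNIV. e (x k)) = (\<Prod>k\<in>UNIV. ennreal ((real m - 1) / pi * (1 - (cmod (x k))\<^sup>2) ^ (m - 2)))"
      using x by (simp add: e_def)
    also have "\<dots> = ennreal (\<Prod>k\<in>UNIV. (real m - 1) / pi * (1 - (cmod (x k))\<^sup>2) ^ (m - 2))"
      using nn by (intro prod_ennreal)
    also have "\<dots> = d (vec_of x)"
      by (simp only: d_def vec_of_nth prod.distrib prod_constant power_divide)
    finally show ?thesis using True by simp
  next
    case False
    then obtain k where "\<not> cmod (x k) < 1" by (auto simp: polydisc_def)
    hence "e (x k) = 0" by (simp add: e_def)
    hence "(\<Prod>k\<in>UNIV. e (x k)) = 0" by (intro prod_zero) auto
    thus ?thesis using False by simp
  qed
  have "(\<integral>\<^sup>+z. F z \<partial>bergman_measure m) = (\<integral>\<^sup>+z. d z * F z \<partial>restrict_space lborel polydisc)"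
    unfolding bergman_measure_def d_def[symmetric]
    by (rule nn_integral_density) (auto intro!: measurable_restrict_space1)
  also have "\<dots> = (\<integral>\<^sup>+z. d z * F z * indicator polydisc z \<partial>lborel)"
    by (rule nn_integral_restrict_space) auto
  also have "\<dots> = (\<integral>\<^sup>+x. d (vec_of x) * F (vec_of x) * indicator polydisc (vec_of x) \<partial>PiM UNIV (\<lambda>_. lborel))"
    by (subst lborel_vec_eq_distr_PiM, subst nn_integral_distr) auto
  also have "\<dots> = (\<integral>\<^sup>+x. (\<Prod>k\<in>UNIV. e (x k)) * F (vec_of x) \<partial>PiM UNIV (\<lambda>_. lborel))"
    unfolding de[symmetric] by (simp add: mult_ac)
  also have "\<dots> = (\<integral>\<^sup>+x. F (vec_of x) \<partial>density (PiM UNIV (\<lambda>_. lborel)) (\<lambda>x. \<Prod>k\<in>UNIV. e (x k)))"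
    by (rule nn_integral_density[symmetric]) measurable
  also have "density (PiM UNIV (\<lambda>_. lborel)) (\<lambda>x. \<Prod>k\<in>(UNIV :: 'n set). e (x k)) = PiM UNIV (\<lambda>_. disc_measure m)"
    unfolding disc
  proof (rule density_PiM)
    show "product_sigma_finite (\<lambda>_::'n. density lborel e)"
      unfolding disc[symmetric] by standard
    show "product_sigma_finite (\<lambda>_::'n. lborel :: complex measure)" by standard
  qed auto
  finally show ?thesis .
qed

text \<open>Measurability is asked only after cutting off to \<open>closed_polydisc\<close>, since
  \<open>F\<close> will be built from a dilation of \<open>f\<close>, whose values outside the
  polydisc are arbitrary. The torus lies in \<open>closed_polydisc\<close>, so the integral does not
  see the cut-off.\<close>

lemma nn_integral_torus_haar:
  fixes F :: "complex ^ 'n::finite \<Rightarrow> ennreal"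
  assumes F: "(\<lambda>z. indicator closed_polydisc z * F z) \<in> borel_measurable borel"
  shows "(\<integral>\<^sup>+w. F w \<partial>torus_haar) = (\<integral>\<^sup>+t. F (vec_of (\<lambda>k. cis (t k))) \<partial>PiM UNIV (\<lambda>_. angle_measure))"
proof -
  have T: "torus \<inter> space borel = (torus :: (complex ^ 'n) set)" by simp
  have "(\<lambda>t. vec_of (\<lambda>k. cis (t k))) \<in> PiM (UNIV :: 'n set) (\<lambda>_. angle_measure) \<rightarrow>\<^sub>M borel"
  proof -
    have "(\<lambda>t. \<lambda>k\<in>UNIV. cis (t k)) \<in> PiM (UNIV :: 'n set) (\<lambda>_. angle_measure) \<rightarrow>\<^sub>M PiM UNIV (\<lambda>_. borel)"
      by measurable
    from measurable_compose[OF this measurable_vec_of] show ?thesis by (simp add: restrict_def)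
  qed
  hence 1: "(\<lambda>t. vec_of (\<lambda>k. cis (t k))) \<in> PiM (UNIV :: 'n set) (\<lambda>_. angle_measure) \<rightarrow>\<^sub>M restrict_space borel torus"
    by (intro measurable_restrict_space2) (auto simp: torus_def)
  have "(\<lambda>z. indicator closed_polydisc z * F z) \<in> borel_measurable (restrict_space borel torus)"
    using F by (rule measurable_restrict_space1)
  hence 2: "F \<in> borel_measurable (restrict_space borel torus)"
    by (subst measurable_cong[where g="\<lambda>z. indicator closed_polydisc z * F z"])
       (auto simp: space_restrict_space torus_def closed_polydisc_def)
  have "torus_haar = distr (PiM (UNIV :: 'n set) (\<lambda>_. angle_measure)) (restrict_space borel torus) (\<lambda>t. vec_of (\<lambda>k. cis (t k)))"
    unfolding torus_haar_def angle_measure_def vec_of_def ..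
  moreover have "F \<in> borel_measurable (distr (PiM (UNIV :: 'n set) (\<lambda>_. angle_measure)) (restrict_space borel torus) (\<lambda>t. vec_of (\<lambda>k. cis (t k))))"
    using 2 by simp
  ultimately show ?thesis using nn_integral_distr[OF 1, of F] by (simp only:)
qed

section \<open>The norm estimate\<close>

lemma real_powr_power:
  fixes x a :: real
  assumes "x \<ge> 0" "n > 0"
  shows "(x powr a) ^ n = x powr (a * real n)"
  using assms by (cases "x = 0") (simp_all add: powr_realpow[symmetric] powr_powr)

lemma torus_integral_le_hp_norm:
  assumes p: "p > 0" and r: "0 < r" "r < 1" and fin: "hp_norm p f < \<infinity>"
    and j: "(\<integral>\<^sup>+w. ennreal (cmod (f (r *\<^sub>R w)) powr p) \<partial>torus_haar) = ennreal j" "j \<ge> 0"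
  shows "j \<le> enn2real (hp_norm p f) powr p"
proof -
  have "ennreal_powr (ennreal j) (1 / p) \<le> hp_norm p f"
    unfolding hp_norm_def j(1)[symmetric] using r by (intro SUP_upper) auto
  hence "ennreal (j powr (1 / p)) \<le> hp_norm p f"
    using j(2) by (simp add: ennreal_powr_def)
  also have "hp_norm p f = ennreal (enn2real (hp_norm p f))" using fin by simp
  finally have "j powr (1 / p) \<le> enn2real (hp_norm p f)" by simp
  hence "(j powr (1 / p)) powr p \<le> enn2real (hp_norm p f) powr p"
    using p by (intro powr_mono2) auto
  thus ?thesis using p j(2) by (simp add: powr_powr)
qed

text \<open>With the exponent \<open>p / 2\<close> the square of the dilated power on the torus is
  \<open>|f(r w)|^p\<close>, whose integral is bounded by the p-th power of
  \<open>hp_norm p f\<close> for every \<open>r\<close>. The result is thus uniform in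
  \<open>r\<close>.\<close>

lemma nn_integral_dilated_power_le:
  fixes f :: "complex ^ 'n::finite \<Rightarrow> complex"
  assumes m: "m \<ge> 2" and p: "p > 2" and f: "f \<in> hp_space p" and r: "0 < r" "r < 1"
  shows "(\<integral>\<^sup>+z. ennreal (dilated_power f r (p / 2) z ^ (2 * m)) \<partial>bergman_measure m)
     \<le> ennreal ((D_const m ^ (2 * m)) ^ CARD('n) * (enn2real (hp_norm p f) powr p) ^ m)"
proof -
  have ph: "pluriharmonic_on polydisc f" and fin: "hp_norm p f < \<infinity>"
    using f by (auto simp: hp_space_def)
  define g where "g x = dilated_power f r (p / 2) (vec_of x)" for x
  have meas [measurable]: "dilated_power f r (p / 2) \<in> borel_measurable borel"
    using p r by (intro dilated_power_measurable ph) auto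
  have g_meas: "g \<in> borel_measurable (PiM UNIV (\<lambda>_. borel))"
    unfolding g_def by measurable
  obtain B where B: "\<And>z. dilated_power f r (p / 2) z \<le> B"
    using dilated_power_bounded[OF ph, of r "p / 2"] p r by auto
  have g0: "0 \<le> g x" for x by (simp add: g_def dilated_power_def)
  have gB: "g x \<le> B" for x using B by (simp add: g_def)
  define j where "j = (LINT t|PiM UNIV (\<lambda>_::'n. angle_measure). (g (\<lambda>k. cis (t k)))\<^sup>2)"
  interpret A: prob_space "PiM UNIV (\<lambda>_::'n. angle_measure)" by (intro prob_space_PiM prob_space_angle_measure)
  have "(\<lambda>t. \<lambda>k\<in>UNIV. cis (t k)) \<in> PiM (UNIV :: 'n set) (\<lambda>_. angle_measure) \<rightarrow>\<^sub>M PiM UNIV (\<lambda>_. borel)"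
    by measurable
  from measurable_compose[OF this g_meas]
  have [measurable]: "(\<lambda>t. g (\<lambda>k. cis (t k))) \<in> borel_measurable (PiM UNIV (\<lambda>_::'n. angle_measure))"
    by (simp add: restrict_def)
  have "integrable (PiM UNIV (\<lambda>_::'n. angle_measure)) (\<lambda>t. (g (\<lambda>k. cis (t k)))\<^sup>2)"
    using g0 B by (intro A.integrable_const_bound[of _ "B\<^sup>2"]) (auto intro!: power_mono gB)
  hence "ennreal j = (\<integral>\<^sup>+t. ennreal ((g (\<lambda>k. cis (t k)))\<^sup>2) \<partial>PiM UNIV (\<lambda>_::'n. angle_measure))"
    unfolding j_def by (intro nn_integral_eq_integral[symmetric]) auto
  also have "\<dots> = (\<integral>\<^sup>+t. ennreal (cmod (f (r *\<^sub>R vec_of (\<lambda>k. cis (t k)))) powr p) \<partial>PiM UNIV (\<lambda>_::'n. angle_measure))"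
    by (simp add: g_def dilated_power_def closed_polydisc_def real_powr_power)
  also have "\<dots> = (\<integral>\<^sup>+w. ennreal (cmod (f (r *\<^sub>R w)) powr p) \<partial>torus_haar)"
  proof (rule nn_integral_torus_haar[symmetric])
    have "dilated_power f r p \<in> borel_measurable borel"
      using p r by (intro dilated_power_measurable ph) auto
    hence "(\<lambda>z. ennreal (dilated_power f r p z)) \<in> borel_measurable borel" by measurable
    thus "(\<lambda>z. indicator closed_polydisc z * ennreal (cmod (f (r *\<^sub>R z)) powr p)) \<in> borel_measurable borel"
      by (simp add: dilated_power_def[abs_def] ennreal_mult' ennreal_indicator)
  qed
  finally have "j \<le> enn2real (hp_norm p f) powr p"
    using p r fin by (intro torus_integral_le_hp_norm[where f=f and r=r]) (auto simp: j_def)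
  moreover have "j \<ge> 0" by (simp add: j_def)
  ultimately have "j ^ m \<le> (enn2real (hp_norm p f) powr p) ^ m" by (intro power_mono)
  hence le: "(D_const m ^ (2 * m)) ^ CARD('n) * j ^ m \<le> (D_const m ^ (2 * m)) ^ CARD('n) * (enn2real (hp_norm p f) powr p) ^ m"
    by (intro mult_left_mono) (auto simp: power_mult)
  have "(\<integral>\<^sup>+z. ennreal (dilated_power f r (p / 2) z ^ (2 * m)) \<partial>bergman_measure m)
     = (\<integral>\<^sup>+x. ennreal (g x ^ (2 * m)) \<partial>PiM UNIV (\<lambda>_. disc_measure m))"
    unfolding g_def by (rule nn_integral_bergman_measure[OF m]) measurable
  also have "\<dots> \<le> ennreal ((D_const m ^ (2 * m)) ^ card (UNIV :: 'n set) *
         (LINT t|PiM UNIV (\<lambda>_::'n. angle_measure). (g (\<lambda>k\<in>UNIV. cis (t k)))\<^sup>2) ^ m)"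
  proof (rule nn_integral_PiM_sub_poisson_power_le[OF m])
    show "g x \<le> B" for x by (rule gB)
    fix i :: 'n and x :: "'n \<Rightarrow> complex"
    show "continuous_on (sphere 0 1) (\<lambda>y. g (x(i := y)))"
      unfolding g_def vec_of_upd using p r by (intro dilated_power_sub_poisson ph) auto
    show "cmod z < 1 \<Longrightarrow> g (x(i := z)) \<le> (LINT t|angle_measure. poisson_kernel z (cis t) * g (x(i := cis t)))" for z
      unfolding g_def vec_of_upd using p r by (intro dilated_power_sub_poisson ph) auto
  qed (use g_meas g0 in auto)
  also have "\<dots> = ennreal ((D_const m ^ (2 * m)) ^ CARD('n) * j ^ m)"
    by (simp add: j_def restrict_def)
  also have "\<dots> \<le> ennreal ((D_const m ^ (2 * m)) ^ CARD('n) * (enn2real (hp_norm p f) powr p) ^ m)"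
    by (rule ennreal_leI[OF le])
  finally show ?thesis .
qed

theorem theorem1p2:
  fixes m :: nat and p :: real and f :: "complex ^ 'n \<Rightarrow> complex"
  assumes "m \<ge> 2" and "p > 2" and "f \<in> hp_space p"
  shows "bergman_norm m (real m * p) f
           \<le> ennreal (D_const m powr (2 * real CARD('n) / p)) * hp_norm p f"
proof -
  note m = assms(1) and p = assms(2)
  have ph: "pluriharmonic_on polydisc f" and fin: "hp_norm p f < \<infinity>"
    using assms(3) by (auto simp: hp_space_def)
  define N where "N = enn2real (hp_norm p f)"
  have N: "N \<ge> 0" "hp_norm p f = ennreal N" using fin by (auto simp: N_def)
  define K where "K = (D_const m ^ (2 * m)) ^ CARD('n) * (N powr p) ^ m"
  have D: "D_const m > 0"
  proof -
    have "pi / (4 * real m) < pi / 2" using m pi_gt_zero by (simp add: field_simps)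
    hence "cos (pi / (4 * real m)) > 0" using m pi_gt_zero by (intro cos_gt_zero) auto
    thus ?thesis by (simp add: D_const_def)
  qed
  \<comment> \<open>The double \<open>Suc\<close> keeps \<open>r 0 = 1/2\<close> positive.\<close>
  define r where "r n = 1 - inverse (real (Suc (Suc n)))" for n
  have r: "0 < r n" "r n < 1" for n by (auto simp: r_def field_simps)
  have r_lim: "r \<longlonglongrightarrow> 1"
    unfolding r_def using tendsto_diff[OF tendsto_const LIMSEQ_Suc[OF LIMSEQ_inverse_real_of_nat], of 1] by simp
  define u where "u n z = ennreal (dilated_power f (r n) (p / 2) z ^ (2 * m))" for n z
  \<comment> \<open>Fatou's lemma along the dilations: continuity of \<open>f\<close> on the
    polydisc gives the pointwise limit, and the bound \<open>K\<close> is the same for all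
    \<open>n\<close>.\<close>
  have "(\<integral>\<^sup>+z. ennreal (cmod (f z) powr (real m * p)) \<partial>bergman_measure m)
     = (\<integral>\<^sup>+z. liminf (\<lambda>n. u n z) \<partial>bergman_measure m)"
  proof (rule nn_integral_cong)
    fix z :: "complex ^ 'n" assume "z \<in> space (bergman_measure m)"
    hence z: "z \<in> polydisc" by (simp add: bergman_measure_def space_restrict_space)
    have zc: "z \<in> closed_polydisc" using z by (auto simp: polydisc_def closed_polydisc_def less_imp_le)
    have "isCont f z"
      using pluriharmonic_imp_continuous_on[OF ph] z open_polydisc continuous_on_eq_continuous_at by blast
    moreover have "(\<lambda>n. r n *\<^sub>R z) \<longlonglongrightarrow> 1 *\<^sub>R z" by (intro tendsto_intros r_lim)
    ultimately have "(\<lambda>n. f (r n *\<^sub>R z)) \<longlonglongrightarrow> f z"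
      by (intro isCont_tendsto_compose[of z f]) simp_all
    hence "(\<lambda>n. ennreal (cmod (f (r n *\<^sub>R z)) powr (real m * p))) \<longlonglongrightarrow> ennreal (cmod (f z) powr (real m * p))"
      using m p by (intro tendsto_ennrealI tendsto_powr' tendsto_norm tendsto_const) auto
    also have "(\<lambda>n. ennreal (cmod (f (r n *\<^sub>R z)) powr (real m * p))) = (\<lambda>n. u n z)"
      using m zc by (simp add: u_def dilated_power_def real_powr_power mult.commute)
    finally show "ennreal (cmod (f z) powr (real m * p)) = liminf (\<lambda>n. u n z)"
      by (intro lim_imp_Liminf[symmetric]) auto
  qed
  also have "\<dots> \<le> liminf (\<lambda>n. \<integral>\<^sup>+z. u n z \<partial>bergman_measure m)"
  proof (rule nn_integral_liminf)
    fix n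
    have [measurable]: "dilated_power f (r n) (p / 2) \<in> borel_measurable borel"
      using p r[of n] by (intro dilated_power_measurable ph) auto
    have "u n \<in> borel_measurable borel" unfolding u_def by measurable
    hence "u n \<in> borel_measurable (restrict_space lborel polydisc)"
      by (intro measurable_restrict_space1) simp
    thus "u n \<in> borel_measurable (bergman_measure m)"
      by (simp add: bergman_measure_def)
  qed
  also have "\<dots> \<le> liminf (\<lambda>n. ennreal K)"
    unfolding u_def K_def N_def
    by (intro Liminf_mono always_eventually allI nn_integral_dilated_power_le m p assms(3) r)
  also have "\<dots> = ennreal K" by (simp add: Liminf_const)
  finally have le: "(\<integral>\<^sup>+z. ennreal (cmod (f z) powr (real m * p)) \<partial>bergman_measure m) \<le> ennreal K" .
  \<comment> \<open>Finiteness has just been shown, so \<open>enn2real\<close> loses nothing and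
    \<open>ennreal_powr\<close> below is a real power.\<close>
  define I where "I = enn2real (\<integral>\<^sup>+z. ennreal (cmod (f z) powr (real m * p)) \<partial>bergman_measure m)"
  have I: "(\<integral>\<^sup>+z. ennreal (cmod (f z) powr (real m * p)) \<partial>bergman_measure m) = ennreal I"
    unfolding I_def using le by (metis ennreal_enn2real ennreal_less_top le_less_trans)
  have I0: "I \<ge> 0" by (simp add: I_def)
  have K0: "K \<ge> 0" using D by (simp add: K_def)
  have "I \<le> K" using le K0 unfolding I by simp
  \<comment> \<open>The exponent \<open>2 * m * CARD('n)\<close> of \<open>D_const m\<close> divided
    by \<open>m * p\<close> gives \<open>2 * CARD('n) / p\<close>, and \<open>N\<close> returns from
    \<open>(N powr p) ^ m\<close> to the first power.\<close>
  have Kp: "K powr (1 / (real m * p)) = D_const m powr (2 * real CARD('n) / p) * N"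
  proof -
    have "K = D_const m powr (real (2 * m * CARD('n))) * N powr (p * real m)"
      using D m by (simp add: K_def powr_realpow power_mult[symmetric] real_powr_power N(1) del: of_nat_mult)
    hence "K powr (1 / (real m * p)) = (D_const m powr (real (2 * m * CARD('n)))) powr (1 / (real m * p))
        * (N powr (p * real m)) powr (1 / (real m * p))"
      by (simp add: powr_mult)
    also have "(D_const m powr (real (2 * m * CARD('n)))) powr (1 / (real m * p)) = D_const m powr (2 * real CARD('n) / p)"
      using m p by (simp add: powr_powr)
    also have "(N powr (p * real m)) powr (1 / (real m * p)) = N"
      using m p N by (simp add: powr_powr)
    finally show ?thesis .
  qed
  have "bergman_norm m (real m * p) f = ennreal (I powr (1 / (real m * p)))"
    unfolding bergman_norm_def I using I0 by (simp add: ennreal_powr_def)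
  also have "\<dots> \<le> ennreal (K powr (1 / (real m * p)))"
    using I0 \<open>I \<le> K\<close> m p by (intro ennreal_leI powr_mono2) auto
  also have "\<dots> = ennreal (D_const m powr (2 * real CARD('n) / p)) * hp_norm p f"
    unfolding Kp N(2) using N(1) by (simp add: ennreal_mult')
  finally show ?thesis .
qed

end
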